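(* Suppose $(\mathcal{M}, S) \models \mathsf{CS}^-$, $D \subseteq M$ is any set of sentences (in the sense of $\mathcal{M}$), and $A = \{ \phi \in D : (\mathcal{M}, S) \models T(\phi) \}$. Then $A$ is separable from $D$.
   Context: $\mathcal{M} \models \mathsf{PA}$. $(\mathcal{M},S) \models \mathsf{CS}^-$ means $S \subseteq M^2$ is a full compositional satisfaction class: every element of $S$ is a pair $(\phi,\alpha)$ with $\phi$ an $\mathcal{L}_{\mathsf{PA}}$-formula in the sense of $\mathcal{M}$ and $\alpha$ an assignment for $\phi$; for atomic $s=t$, $S(s=t,\alpha)$ iff $s^\alpha=t^\alpha$; $S(\phi\vee\psi,\alpha)$ iff $S(\phi,\alpha\restriction\phi)$ or $S(\psi,\alpha\restriction\psi)$; $S(\neg\phi,\alpha)$ iff not $S(\phi,\alpha)$; $S(\exists v\phi,\alpha)$ iff there is $\beta$ differing from $\alpha$ at most at $v$ with $S(\phi,\beta\restriction\phi)$. $T(\phi)$ abbreviates $S(\phi,\emptyset)$. For $A \subseteq D \subseteq M$, $A$ is separable from $D$ if for each $a\in M$ such that $(a)_n \in D$ for all $n\in\omega$ (where $(a)_n$ is the $n$-th element of the sequence coded by $a$), there is $c\in M$ such that for each $n\in\omega$, $(a)_n\in A$ iff $\mathcal{M}\models n\in c$. *)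

theory Defs
  imports Main
begin

datatype tm = Var nat | Zero | Succ tm | Plus tm tm | Times tm tm

datatype fm = Eq tm tm | Or fm fm | Neg fm | Exi nat fm

text \<open>A structure for the language \<open>{0, S, +, \<times>}\<close>; its universe is the whole type \<open>'a\<close>.\<close>

record 'a arith =
  zer :: 'a
  suc :: "'a \<Rightarrow> 'a"
  add :: "'a \<Rightarrow> 'a \<Rightarrow> 'a"
  mul :: "'a \<Rightarrow> 'a \<Rightarrow> 'a"

primrec tm_val :: "'a arith \<Rightarrow> (nat \<Rightarrow> 'a) \<Rightarrow> tm \<Rightarrow> 'a" where
  "tm_val M e (Var i) = e i"
| "tm_val M e Zero = zer M"
| "tm_val M e (Succ s) = suc M (tm_val M e s)"
| "tm_val M e (Plus s t) = add M (tm_val M e s) (tm_val M e t)"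
| "tm_val M e (Times s t) = mul M (tm_val M e s) (tm_val M e t)"

primrec sat :: "'a arith \<Rightarrow> (nat \<Rightarrow> 'a) \<Rightarrow> fm \<Rightarrow> bool" where
  "sat M e (Eq s t) \<longleftrightarrow> tm_val M e s = tm_val M e t"
| "sat M e (Or \<phi> \<psi>) \<longleftrightarrow> sat M e \<phi> \<or> sat M e \<psi>"
| "sat M e (Neg \<phi>) \<longleftrightarrow> \<not> sat M e \<phi>"
| "sat M e (Exi v \<phi>) \<longleftrightarrow> (\<exists>x. sat M (e(v := x)) \<phi>)"

definition PA_model :: "'a arith \<Rightarrow> bool" where
  "PA_model M \<longleftrightarrow>
     (\<forall>x. suc M x \<noteq> zer M) \<and>
     (\<forall>x y. suc M x = suc M y \<longrightarrow> x = y) \<and>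
     (\<forall>x. add M x (zer M) = x) \<and>
     (\<forall>x y. add M x (suc M y) = suc M (add M x y)) \<and>
     (\<forall>x. mul M x (zer M) = zer M) \<and>
     (\<forall>x y. mul M x (suc M y) = add M (mul M x y) x) \<and>
     (\<forall>\<phi> v e. sat M (e(v := zer M)) \<phi> \<longrightarrow>
        (\<forall>x. sat M (e(v := x)) \<phi> \<longrightarrow> sat M (e(v := suc M x)) \<phi>) \<longrightarrow>
        (\<forall>x. sat M (e(v := x)) \<phi>))"

definition num :: "'a arith \<Rightarrow> nat \<Rightarrow> 'a" where
  "num M n = (suc M ^^ n) (zer M)"

text \<open>
  In the predicates up to and including \<open>term_val\<close> every quantifier ranges over the universe of
  \<open>M\<close>, so that each predicate is the relation defined in \<open>M\<close> by the corresponding arithmetical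
  formula.
\<close>

definition lt :: "'a arith \<Rightarrow> 'a \<Rightarrow> 'a \<Rightarrow> bool" where
  "lt M x y \<longleftrightarrow> (\<exists>z. add M x (suc M z) = y)"

text \<open>\<open>(x + y)\<^sup>2 + x\<close> is injective because \<open>x \<le> x + y\<close>, hence it lies in
  \<open>[(x + y)\<^sup>2, (x + y + 1)\<^sup>2)\<close>.\<close>

definition pair :: "'a arith \<Rightarrow> 'a \<Rightarrow> 'a \<Rightarrow> 'a" where
  "pair M x y = add M (mul M (add M x y) (add M x y)) x"

text \<open>Goedel's beta function as a relation: \<open>r\<close> is the remainder of \<open>u\<close> modulo \<open>1 + (i + 1) v\<close>.\<close>

definition beta :: "'a arith \<Rightarrow> 'a \<Rightarrow> 'a \<Rightarrow> 'a \<Rightarrow> 'a \<Rightarrow> bool" where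
  "beta M u v i r \<longleftrightarrow>
     lt M r (suc M (mul M (suc M i) v)) \<and>
     (\<exists>q. u = add M (mul M q (suc M (mul M (suc M i) v))) r)"

text \<open>\<open>p = 2\<^sup>n\<close>\<close>

definition pow2 :: "'a arith \<Rightarrow> 'a \<Rightarrow> 'a \<Rightarrow> bool" where
  "pow2 M n p \<longleftrightarrow> (\<exists>u v.
     beta M u v (zer M) (suc M (zer M)) \<and>
     (\<forall>i. lt M i n \<longrightarrow> (\<exists>y. beta M u v i y \<and> beta M u v (suc M i) (add M y y))) \<and>
     beta M u v n p)"

text \<open>Ackermann membership: the \<open>n\<close>-th binary digit of \<open>c\<close> is 1. In particular \<open>zer M\<close> codes
  the empty set, and coded sets are extensional.\<close>

definition mem :: "'a arith \<Rightarrow> 'a \<Rightarrow> 'a \<Rightarrow> bool" where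
  "mem M n c \<longleftrightarrow> (\<exists>p q r. pow2 M n p \<and> lt M r p \<and> c = add M (mul M (suc M (add M q q)) p) r)"

definition is_fun :: "'a arith \<Rightarrow> 'a \<Rightarrow> bool" where
  "is_fun M f \<longleftrightarrow>
     (\<forall>z. mem M z f \<longrightarrow> (\<exists>x y. z = pair M x y)) \<and>
     (\<forall>x y y'. mem M (pair M x y) f \<longrightarrow> mem M (pair M x y') f \<longrightarrow> y = y')"

definition is_seq :: "'a arith \<Rightarrow> 'a \<Rightarrow> bool" where
  "is_seq M a \<longleftrightarrow> is_fun M a \<and> (\<exists>l. \<forall>i. (\<exists>x. mem M (pair M i x) a) \<longleftrightarrow> lt M i l)"

text \<open>\<open>a\<close> codes a sequence of length greater than \<open>n\<close> and \<open>x = (a)\<^sub>n\<close>.\<close>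

definition seq_nth :: "'a arith \<Rightarrow> 'a \<Rightarrow> 'a \<Rightarrow> 'a \<Rightarrow> bool" where
  "seq_nth M a n x \<longleftrightarrow> is_seq M a \<and> mem M (pair M n x) a"

definition cVar :: "'a arith \<Rightarrow> 'a \<Rightarrow> 'a" where
  "cVar M i = pair M (num M 1) i"

definition cZero :: "'a arith \<Rightarrow> 'a" where
  "cZero M = pair M (num M 2) (zer M)"

definition cSucc :: "'a arith \<Rightarrow> 'a \<Rightarrow> 'a" where
  "cSucc M s = pair M (num M 3) s"

definition cPlus :: "'a arith \<Rightarrow> 'a \<Rightarrow> 'a \<Rightarrow> 'a" where
  "cPlus M s t = pair M (num M 4) (pair M s t)"

definition cTimes :: "'a arith \<Rightarrow> 'a \<Rightarrow> 'a \<Rightarrow> 'a" where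
  "cTimes M s t = pair M (num M 5) (pair M s t)"

definition cEq :: "'a arith \<Rightarrow> 'a \<Rightarrow> 'a \<Rightarrow> 'a" where
  "cEq M s t = pair M (num M 6) (pair M s t)"

definition cOr :: "'a arith \<Rightarrow> 'a \<Rightarrow> 'a \<Rightarrow> 'a" where
  "cOr M \<phi> \<psi> = pair M (num M 7) (pair M \<phi> \<psi>)"

definition cNeg :: "'a arith \<Rightarrow> 'a \<Rightarrow> 'a" where
  "cNeg M \<phi> = pair M (num M 8) \<phi>"

definition cEx :: "'a arith \<Rightarrow> 'a \<Rightarrow> 'a \<Rightarrow> 'a" where
  "cEx M v \<phi> = pair M (num M 9) (pair M v \<phi>)"

text \<open>
  The recursive notions below are expressed by the existence of a coded set \<open>c\<close> which is closed
  under passing to the immediate subexpressions required by the recursion. As the code of an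
  expression is larger than the codes of its immediate subexpressions, such a set is well-founded
  in \<open>M\<close>; listed in increasing order it is a formation sequence.
\<close>

definition is_term :: "'a arith \<Rightarrow> 'a \<Rightarrow> bool" where
  "is_term M x \<longleftrightarrow> (\<exists>c. mem M x c \<and> (\<forall>y. mem M y c \<longrightarrow>
     (\<exists>i. y = cVar M i) \<or>
     y = cZero M \<or>
     (\<exists>s. y = cSucc M s \<and> mem M s c) \<or>
     (\<exists>s t. y = cPlus M s t \<and> mem M s c \<and> mem M t c) \<or>
     (\<exists>s t. y = cTimes M s t \<and> mem M s c \<and> mem M t c)))"

definition is_form :: "'a arith \<Rightarrow> 'a \<Rightarrow> bool" where
  "is_form M x \<longleftrightarrow> (\<exists>c. mem M x c \<and> (\<forall>y. mem M y c \<longrightarrow>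
     (\<exists>s t. y = cEq M s t \<and> is_term M s \<and> is_term M t) \<or>
     (\<exists>\<phi> \<psi>. y = cOr M \<phi> \<psi> \<and> mem M \<phi> c \<and> mem M \<psi> c) \<or>
     (\<exists>\<phi>. y = cNeg M \<phi> \<and> mem M \<phi> c) \<or>
     (\<exists>v \<phi>. y = cEx M v \<phi> \<and> mem M \<phi> c)))"

text \<open>For occurrences of a variable \<open>v\<close>, the coded set contains a branch of the syntax tree leading
  to an occurrence (in the case of formulas, a free occurrence) of \<open>v\<close>.\<close>

definition occurs :: "'a arith \<Rightarrow> 'a \<Rightarrow> 'a \<Rightarrow> bool" where
  "occurs M v x \<longleftrightarrow> (\<exists>c. mem M x c \<and> (\<forall>y. mem M y c \<longrightarrow>
     y = cVar M v \<or>
     (\<exists>s. y = cSucc M s \<and> mem M s c) \<or>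
     (\<exists>s t. y = cPlus M s t \<and> (mem M s c \<or> mem M t c)) \<or>
     (\<exists>s t. y = cTimes M s t \<and> (mem M s c \<or> mem M t c))))"

definition free_in :: "'a arith \<Rightarrow> 'a \<Rightarrow> 'a \<Rightarrow> bool" where
  "free_in M v x \<longleftrightarrow> (\<exists>c. mem M x c \<and> (\<forall>y. mem M y c \<longrightarrow>
     (\<exists>s t. y = cEq M s t \<and> (occurs M v s \<or> occurs M v t)) \<or>
     (\<exists>\<phi> \<psi>. y = cOr M \<phi> \<psi> \<and> (mem M \<phi> c \<or> mem M \<psi> c)) \<or>
     (\<exists>\<phi>. y = cNeg M \<phi> \<and> mem M \<phi> c) \<or>
     (\<exists>u \<phi>. y = cEx M u \<phi> \<and> u \<noteq> v \<and> mem M \<phi> c)))"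

definition is_sent :: "'a arith \<Rightarrow> 'a \<Rightarrow> bool" where
  "is_sent M \<phi> \<longleftrightarrow> is_form M \<phi> \<and> (\<forall>v. \<not> free_in M v \<phi>)"

text \<open>Assignments for a formula are coded functions whose domain is exactly the set of (indices of)
  its free variables.\<close>

definition is_asg :: "'a arith \<Rightarrow> 'a \<Rightarrow> 'a \<Rightarrow> bool" where
  "is_asg M \<phi> \<alpha> \<longleftrightarrow>
     is_fun M \<alpha> \<and> (\<forall>v. (\<exists>x. mem M (pair M v x) \<alpha>) \<longleftrightarrow> free_in M v \<phi>)"

text \<open>\<open>\<beta> = \<alpha>\<restriction>\<phi>\<close>\<close>

definition restr :: "'a arith \<Rightarrow> 'a \<Rightarrow> 'a \<Rightarrow> 'a \<Rightarrow> bool" where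
  "restr M \<alpha> \<phi> \<beta> \<longleftrightarrow> is_asg M \<phi> \<beta> \<and> (\<forall>z. mem M z \<beta> \<longrightarrow> mem M z \<alpha>)"

definition differ_at_most :: "'a arith \<Rightarrow> 'a \<Rightarrow> 'a \<Rightarrow> 'a \<Rightarrow> bool" where
  "differ_at_most M v \<alpha> \<beta> \<longleftrightarrow>
     is_fun M \<alpha> \<and> is_fun M \<beta> \<and>
     (\<forall>i x. i \<noteq> v \<longrightarrow> (mem M (pair M i x) \<alpha> \<longleftrightarrow> mem M (pair M i x) \<beta>))"

text \<open>\<open>x\<close> is the value \<open>s\<^sup>\<alpha>\<close>; \<open>f\<close> codes the values of the subterms of \<open>s\<close>.\<close>

definition term_val :: "'a arith \<Rightarrow> 'a \<Rightarrow> 'a \<Rightarrow> 'a \<Rightarrow> bool" where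
  "term_val M \<alpha> s x \<longleftrightarrow> (\<exists>f. is_fun M f \<and> mem M (pair M s x) f \<and>
     (\<forall>t y. mem M (pair M t y) f \<longrightarrow>
       (\<exists>i. t = cVar M i \<and> mem M (pair M i y) \<alpha>) \<or>
       (t = cZero M \<and> y = zer M) \<or>
       (\<exists>t1 y1. t = cSucc M t1 \<and> mem M (pair M t1 y1) f \<and> y = suc M y1) \<or>
       (\<exists>t1 t2 y1 y2. t = cPlus M t1 t2 \<and> mem M (pair M t1 y1) f \<and> mem M (pair M t2 y2) f \<and>
          y = add M y1 y2) \<or>
       (\<exists>t1 t2 y1 y2. t = cTimes M t1 t2 \<and> mem M (pair M t1 y1) f \<and> mem M (pair M t2 y2) f \<and>
          y = mul M y1 y2)))"

definition CS_minus :: "'a arith \<Rightarrow> ('a \<times> 'a) set \<Rightarrow> bool" where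
  "CS_minus M S \<longleftrightarrow>
     PA_model M \<and>
     (\<forall>(\<phi>, \<alpha>) \<in> S. is_form M \<phi> \<and> is_asg M \<phi> \<alpha>) \<and>
     (\<forall>s t \<alpha>. is_term M s \<longrightarrow> is_term M t \<longrightarrow> is_asg M (cEq M s t) \<alpha> \<longrightarrow>
        ((cEq M s t, \<alpha>) \<in> S \<longleftrightarrow> (\<exists>x. term_val M \<alpha> s x \<and> term_val M \<alpha> t x))) \<and>
     (\<forall>\<phi> \<psi> \<alpha>. is_form M \<phi> \<longrightarrow> is_form M \<psi> \<longrightarrow> is_asg M (cOr M \<phi> \<psi>) \<alpha> \<longrightarrow>
        ((cOr M \<phi> \<psi>, \<alpha>) \<in> S \<longleftrightarrow>
          (\<exists>\<beta>. restr M \<alpha> \<phi> \<beta> \<and> (\<phi>, \<beta>) \<in> S) \<or> (\<exists>\<beta>. restr M \<alpha> \<psi> \<beta> \<and> (\<psi>, \<beta>) \<in> S))) \<and>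
     (\<forall>\<phi> \<alpha>. is_form M \<phi> \<longrightarrow> is_asg M (cNeg M \<phi>) \<alpha> \<longrightarrow>
        ((cNeg M \<phi>, \<alpha>) \<in> S \<longleftrightarrow> (\<phi>, \<alpha>) \<notin> S)) \<and>
     (\<forall>v \<phi> \<alpha>. is_form M \<phi> \<longrightarrow> is_asg M (cEx M v \<phi>) \<alpha> \<longrightarrow>
        ((cEx M v \<phi>, \<alpha>) \<in> S \<longleftrightarrow>
          (\<exists>\<beta> \<gamma>. differ_at_most M v \<alpha> \<beta> \<and> restr M \<beta> \<phi> \<gamma> \<and> (\<phi>, \<gamma>) \<in> S)))"

text \<open>\<open>zer M\<close> codes the empty assignment.\<close>

definition holds :: "'a arith \<Rightarrow> ('a \<times> 'a) set \<Rightarrow> 'a \<Rightarrow> bool" where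
  "holds M S \<phi> \<longleftrightarrow> (\<phi>, zer M) \<in> S"

definition separable :: "'a arith \<Rightarrow> 'a set \<Rightarrow> 'a set \<Rightarrow> bool" where
  "separable M A D \<longleftrightarrow> A \<subseteq> D \<and>
     (\<forall>a. (\<forall>n. \<exists>x\<in>D. seq_nth M a (num M n) x) \<longrightarrow>
        (\<exists>c. \<forall>n. (\<exists>x\<in>A. seq_nth M a (num M n) x) \<longleftrightarrow> mem M (num M n) c))"

end

theory Submission
  imports Defs
begin

text \<open>
  Let \<open>\<sigma>\<^sub>n\<close> be the \<open>n\<close>-th sentence of the sequence \<open>a\<close> and suppose that no element of \<open>M\<close> codes the set of
  standard \<open>n\<close> with \<open>T(\<sigma>\<^sub>n)\<close>. Then every \<open>x\<close> has a first standard position \<open>r(x)\<close> at which its binary digit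
  differs from the truth value of \<open>\<sigma>\<^sub>n\<close>. Inside \<open>M\<close> define formulas \<open>\<theta>\<^sub>m\<^sub>,\<^sub>n(v\<^sub>n)\<close> by recursion on \<open>m\<close>:
  \<open>\<theta>\<^sub>m\<^sub>+\<^sub>1\<^sub>,\<^sub>n(v\<^sub>n)\<close> compares the last digit of \<open>v\<^sub>n\<close> with \<open>\<sigma>\<^sub>n\<close>; if they agree it is \<open>\<theta>\<^sub>m\<^sub>,\<^sub>n\<^sub>+\<^sub>1\<close> evaluated at
  \<open>v\<^sub>n div 2\<close>, otherwise it is the sentence \<open>Y\<^sub>m = \<not> \<exists>v\<^sub>0 \<theta>\<^sub>m\<^sub>,\<^sub>0\<close>. For nonstandard \<open>m\<close> the compositional clauses,
  used only standardly often, show that \<open>\<theta>\<^sub>m\<^sub>,\<^sub>0(x)\<close> is equivalent to \<open>Y\<^bsub>m-r(x)-1\<^esub>\<close>. As \<open>r\<close> takes every standard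
  value, \<open>Y\<^sub>m\<close> holds iff \<open>Y\<^bsub>m-i-1\<^esub>\<close> fails for all standard \<open>i\<close>, which is Yablo's paradox.
\<close>

section \<open>Definability with parameters\<close>

text \<open>The obstacle is that \<open>PA_model\<close> gives induction for definable predicates
  only, and \<open>CS_minus\<close> adds none for predicates that mention the satisfaction class.
  The work is therefore split: whatever concerns the syntax of the \<theta> is proved by induction
  inside \<open>M\<close>, through nonstandard stages, and whatever concerns truth by ordinary
  induction over \<open>nat\<close>. The recursion is shaped by this split. A formula of stage m + 1
  is built from two formulas of stage m and one sentence by a fixed number of connectives, so
  descending one stage costs a fixed finite number of compositional clauses. Digits are read by
  halving because the equations x = 2z and x = 2z + 1 are atomic and can be evaluated directly. A
  nonstandard m is available because the length of \<open>a\<close> exceeds every numeral. Yablo's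
  paradox fits better than the Liar: Y_m depends only on sentences with smaller index, so no fixed
  point is required, and the indices d, d - 1, d - 2, ... below a nonstandard d descend without
  end.\<close>

text \<open>Definable predicates are handled semantically, as predicates of an environment in de Bruijn style:
  the quantifier binds argument 0. Elements of \<open>A\<close> may occur as parameters.\<close>

inductive dterm :: "'a arith \<Rightarrow> 'a set \<Rightarrow> ((nat \<Rightarrow> 'a) \<Rightarrow> 'a) \<Rightarrow> bool" for M A where
  var: "dterm M A (\<lambda>e. e i)"
| const: "c \<in> A \<Longrightarrow> dterm M A (\<lambda>e. c)"
| zero: "dterm M A (\<lambda>e. zer M)"
| suc: "dterm M A f \<Longrightarrow> dterm M A (\<lambda>e. suc M (f e))"
| add: "dterm M A f \<Longrightarrow> dterm M A g \<Longrightarrow> dterm M A (\<lambda>e. add M (f e) (g e))"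
| mul: "dterm M A f \<Longrightarrow> dterm M A g \<Longrightarrow> dterm M A (\<lambda>e. mul M (f e) (g e))"

inductive dfn :: "'a arith \<Rightarrow> 'a set \<Rightarrow> ((nat \<Rightarrow> 'a) \<Rightarrow> bool) \<Rightarrow> bool" for M A where
  eq: "dterm M A f \<Longrightarrow> dterm M A g \<Longrightarrow> dfn M A (\<lambda>e. f e = g e)"
| disj: "dfn M A P \<Longrightarrow> dfn M A Q \<Longrightarrow> dfn M A (\<lambda>e. P e \<or> Q e)"
| neg: "dfn M A P \<Longrightarrow> dfn M A (\<lambda>e. \<not> P e)"
| bex: "dfn M A P \<Longrightarrow> dfn M A (\<lambda>e. \<exists>x. P (case_nat x e))"

lemma dterm_mono: "dterm M A f \<Longrightarrow> A \<subseteq> B \<Longrightarrow> dterm M B f"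
  by (induction rule: dterm.induct) (auto intro: dterm.intros)

lemma dfn_mono: "dfn M A P \<Longrightarrow> A \<subseteq> B \<Longrightarrow> dfn M B P"
proof (induction rule: dfn.induct)
  case (eq f g)
  show ?case by (intro dfn.eq eq.hyps[THEN dterm_mono] eq.prems)
next
  case (disj P Q)
  then show ?case by (intro dfn.disj)
next
  case (neg P)
  then show ?case by (intro dfn.neg)
next
  case (bex P)
  show ?case by (rule dfn.bex[OF bex.IH[OF bex.prems]])
qed

lemma dterm_finite: "dterm M B f \<Longrightarrow> \<exists>A. finite A \<and> dterm M A f"
proof (induction rule: dterm.induct)
  case (const c)
  have "dterm M {c} (\<lambda>e. c)" by (auto intro: dterm.const)
  then show ?case by (intro exI[of _ "{c}"]) simp
next
  case (add f g)
  then obtain A1 A2 where "finite A1" "dterm M A1 f" "finite A2" "dterm M A2 g" by blast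
  then have "finite (A1 \<union> A2)" "dterm M (A1 \<union> A2) f" "dterm M (A1 \<union> A2) g"
    by (auto elim: dterm_mono)
  then show ?case by (intro exI[of _ "A1 \<union> A2"] conjI dterm.add)
next
  case (mul f g)
  then obtain A1 A2 where "finite A1" "dterm M A1 f" "finite A2" "dterm M A2 g" by blast
  then have "finite (A1 \<union> A2)" "dterm M (A1 \<union> A2) f" "dterm M (A1 \<union> A2) g"
    by (auto elim: dterm_mono)
  then show ?case by (intro exI[of _ "A1 \<union> A2"] conjI dterm.mul)
next
  case (var i)
  show ?case by (intro exI[of _ "{}"] conjI finite.emptyI dterm.var)
next
  case zero
  show ?case by (intro exI[of _ "{}"] conjI finite.emptyI dterm.zero)
next
  case (suc f)
  then show ?case by (blast intro: dterm.suc)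
qed

text \<open>An environment stores only countably many parameters, while \<open>M\<close> may be
  uncountable. A derivation of \<open>dfn\<close> mentions finitely many constants, and these can be
  listed in variables.\<close>

lemma dfn_finite: "dfn M B P \<Longrightarrow> \<exists>A. finite A \<and> dfn M A P"
proof (induction rule: dfn.induct)
  case (eq f g)
  then obtain A1 A2 where "finite A1" "dterm M A1 f" "finite A2" "dterm M A2 g"
    using dterm_finite by meson
  then have "finite (A1 \<union> A2)" "dterm M (A1 \<union> A2) f" "dterm M (A1 \<union> A2) g"
    by (auto elim: dterm_mono)
  then show ?case by (intro exI[of _ "A1 \<union> A2"] conjI dfn.eq)
next
  case (disj P Q)
  then obtain A1 A2 where "finite A1" "dfn M A1 P" "finite A2" "dfn M A2 Q" by blast
  then have "finite (A1 \<union> A2)" "dfn M (A1 \<union> A2) P" "dfn M (A1 \<union> A2) Q"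
    by (auto elim: dfn_mono)
  then show ?case by (intro exI[of _ "A1 \<union> A2"] conjI dfn.disj)
next
  case (neg P)
  then show ?case by (blast intro: dfn.neg)
next
  case (bex P)
  then obtain A where A: "finite A" "dfn M A P" by blast
  show ?case using A(1) dfn.bex[OF A(2)] by blast
qed

lemma dterm_subst:
  assumes "dterm M A h" and f: "\<And>i. dterm M A (f i)"
  shows "dterm M A (\<lambda>e. h (\<lambda>i. f i e))"
  using assms(1)
proof (induction rule: dterm.induct)
  case (var i)
  show ?case by (rule f)
next
  case (const c)
  then show ?case by (rule dterm.const)
next
  case zero
  show ?case by (rule dterm.zero)
next
  case (suc h)
  show ?case by (rule dterm.suc[OF suc.IH])
next
  case (add h1 h2)
  show ?case by (rule dterm.add[OF add.IH])
next
  case (mul h1 h2)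
  show ?case by (rule dterm.mul[OF mul.IH])
qed

lemma dfn_subst:
  fixes M :: "'a arith"
  assumes "dfn M A P" and "\<And>i. dterm M A (f i)"
  shows "dfn M A (\<lambda>e. P (\<lambda>i. f i e))"
proof -
  have "\<forall>f. (\<forall>i. dterm M A (f i)) \<longrightarrow> dfn M A (\<lambda>e. P (\<lambda>i. f i e))"
    using assms(1)
  proof (induction rule: dfn.induct)
    case (eq g h)
    show ?case by (intro allI impI dfn.eq eq.hyps[THEN dterm_subst]) simp_all
  next
    case (disj P Q)
    show ?case by (intro allI impI dfn.disj disj.IH[rule_format]) simp_all
  next
    case (neg P)
    show ?case by (intro allI impI dfn.neg neg.IH[rule_format]) simp
  next
    case (bex P)
    show ?case
    proof (intro allI impI)
      fix f :: "nat \<Rightarrow> (nat \<Rightarrow> 'a) \<Rightarrow> 'a" assume f: "\<forall>i. dterm M A (f i)"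
      \<comment> \<open>The substitution lifted under a binder: argument 0 stays put and the old
        substitution reads the environment shifted by one.\<close>
      define f' where "f' = case_nat (\<lambda>e. e 0) (\<lambda>i e. f i (\<lambda>j. e (Suc j)))"
      have "dterm M A (f' i)" for i
      proof (cases i)
        case 0
        then show ?thesis unfolding f'_def by (simp add: dterm.var)
      next
        case (Suc j)
        have "dterm M A (\<lambda>e. f j (\<lambda>k. e (Suc k)))"
          by (rule dterm_subst[OF f[rule_format], of "\<lambda>k e. e (Suc k)"]) (rule dterm.var)
        then show ?thesis unfolding f'_def Suc by simp
      qed
      then have "dfn M A (\<lambda>e. P (\<lambda>i. f' i e))" using bex.IH by blast
      from dfn.bex[OF this] have "dfn M A (\<lambda>e. \<exists>x. P (\<lambda>i. f' i (case_nat x e)))" .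
      moreover have "(\<lambda>i. f' i (case_nat x e)) = case_nat x (\<lambda>i. f i e)" for x e
        by (auto simp: f'_def fun_eq_iff split: nat.split)
      ultimately show "dfn M A (\<lambda>e. \<exists>x. P (case_nat x (\<lambda>i. f i e)))" by simp
    qed
  qed
  then show ?thesis using assms(2) by blast
qed

lemma dterm_tm:
  assumes "dterm M (range \<rho>) h"
  shows "\<exists>t. \<forall>e. (\<forall>j. e (g j) = \<rho> j) \<longrightarrow> tm_val M e t = h (\<lambda>i. e (f i))"
  using assms
proof (induction rule: dterm.induct)
  case (var i)
  then show ?case by (intro exI[of _ "Var (f i)"] allI impI) simp
next
  case (const c)
  then obtain j where "c = \<rho> j" by auto
  then show ?case by (intro exI[of _ "Var (g j)"] allI impI) simp
next
  case zero
  then show ?case by (intro exI[of _ Zero] allI impI) simp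
next
  case (suc h)
  then obtain t where "\<forall>e. (\<forall>j. e (g j) = \<rho> j) \<longrightarrow> tm_val M e t = h (\<lambda>i. e (f i))" by blast
  then show ?case by (intro exI[of _ "Succ t"] allI impI) simp
next
  case (add h1 h2)
  then obtain t1 t2 where "\<forall>e. (\<forall>j. e (g j) = \<rho> j) \<longrightarrow> tm_val M e t1 = h1 (\<lambda>i. e (f i))"
    "\<forall>e. (\<forall>j. e (g j) = \<rho> j) \<longrightarrow> tm_val M e t2 = h2 (\<lambda>i. e (f i))" by blast
  then show ?case by (intro exI[of _ "Plus t1 t2"] allI impI) simp
next
  case (mul h1 h2)
  then obtain t1 t2 where "\<forall>e. (\<forall>j. e (g j) = \<rho> j) \<longrightarrow> tm_val M e t1 = h1 (\<lambda>i. e (f i))"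
    "\<forall>e. (\<forall>j. e (g j) = \<rho> j) \<longrightarrow> tm_val M e t2 = h2 (\<lambda>i. e (f i))" by blast
  then show ?case by (intro exI[of _ "Times t1 t2"] allI impI) simp
qed

text \<open>Variable \<open>f i\<close> stands for the \<open>i\<close>-th argument and variable \<open>g j\<close> for the \<open>j\<close>-th parameter; infinitely many
  variables stay unused, so that a fresh one is available at each quantifier.\<close>

lemma dfn_fm:
  assumes "dfn M (range \<rho>) P" "infinite (- (range f \<union> range g))"
  shows "\<exists>\<phi>. \<forall>e. (\<forall>j. e (g j) = \<rho> j) \<longrightarrow> (sat M e \<phi> \<longleftrightarrow> P (\<lambda>i. e (f i)))"
  using assms
proof (induction arbitrary: f rule: dfn.induct)
  case (eq h1 h2)
  from dterm_tm[OF eq(1)] obtain t1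
    where t1: "\<forall>e. (\<forall>j. e (g j) = \<rho> j) \<longrightarrow> tm_val M e t1 = h1 (\<lambda>i. e (f i))" ..
  from dterm_tm[OF eq(2)] obtain t2
    where t2: "\<forall>e. (\<forall>j. e (g j) = \<rho> j) \<longrightarrow> tm_val M e t2 = h2 (\<lambda>i. e (f i))" ..
  show ?case by (intro exI[of _ "Eq t1 t2"] allI impI) (simp add: t1 t2)
next
  case (disj P Q)
  from disj.IH(1)[OF disj.prems] obtain \<phi> where \<phi>: "\<forall>e. (\<forall>j. e (g j) = \<rho> j) \<longrightarrow> (sat M e \<phi> \<longleftrightarrow> P (\<lambda>i. e (f i)))" ..
  from disj.IH(2)[OF disj.prems] obtain \<psi> where \<psi>: "\<forall>e. (\<forall>j. e (g j) = \<rho> j) \<longrightarrow> (sat M e \<psi> \<longleftrightarrow> Q (\<lambda>i. e (f i)))" ..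
  show ?case by (intro exI[of _ "Or \<phi> \<psi>"] allI impI) (simp add: \<phi> \<psi>)
next
  case (neg P)
  from neg.IH[OF neg.prems] obtain \<phi> where \<phi>: "\<forall>e. (\<forall>j. e (g j) = \<rho> j) \<longrightarrow> (sat M e \<phi> \<longleftrightarrow> P (\<lambda>i. e (f i)))" ..
  show ?case by (intro exI[of _ "Neg \<phi>"] allI impI) (simp add: \<phi>)
next
  case (bex P)
  have "- (range f \<union> range g) \<noteq> {}" using bex.prems infinite_imp_nonempty by blast
  then obtain w where w: "w \<notin> range f" "w \<notin> range g" by blast
  define f' where "f' = case_nat w f"
  have "range f' \<subseteq> insert w (range f)"
    unfolding f'_def by (auto split: nat.split)
  then have "- (range f \<union> range g) - {w} \<subseteq> - (range f' \<union> range g)" by blast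
  moreover have "infinite (- (range f \<union> range g) - {w})"
    using bex.prems by (simp only: infinite_remove not_False_eq_True)
  ultimately have "infinite (- (range f' \<union> range g))" using finite_subset by blast
  from bex.IH[OF this] obtain \<phi> where \<phi>: "\<forall>e. (\<forall>j. e (g j) = \<rho> j) \<longrightarrow> (sat M e \<phi> \<longleftrightarrow> P (\<lambda>i. e (f' i)))" ..
  have "sat M e (Exi w \<phi>) \<longleftrightarrow> (\<exists>x. P (case_nat x (\<lambda>i. e (f i))))" if e: "\<forall>j. e (g j) = \<rho> j" for e
  proof -
    have "(\<lambda>i. (e(w := x)) (f' i)) = case_nat x (\<lambda>i. e (f i))" for x
      using w(1) by (auto simp: f'_def fun_eq_iff split: nat.split)
    moreover have "\<forall>j. (e(w := x)) (g j) = \<rho> j" for x using e w(2) by auto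
    ultimately show ?thesis using \<phi> by simp
  qed
  then show ?case by (intro exI[of _ "Exi w \<phi>"] allI impI)
qed

lemma dfn_conj:
  assumes "dfn M A P" "dfn M A Q"
  shows "dfn M A (\<lambda>e. P e \<and> Q e)"
proof -
  have "dfn M A (\<lambda>e. \<not> (\<not> P e \<or> \<not> Q e))" by (intro dfn.neg dfn.disj assms)
  then show ?thesis by simp
qed

lemma dfn_imp:
  assumes "dfn M A P" "dfn M A Q"
  shows "dfn M A (\<lambda>e. P e \<longrightarrow> Q e)"
  unfolding imp_conv_disj by (intro dfn.neg dfn.disj assms)

lemma dfn_iff: "dfn M A P \<Longrightarrow> dfn M A Q \<Longrightarrow> dfn M A (\<lambda>e. P e \<longleftrightarrow> Q e)"
  unfolding iff_conv_conj_imp by (intro dfn_conj dfn_imp)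

lemma dfn_const: "dfn M A (\<lambda>e. Q)"
proof -
  have 1: "dfn M A (\<lambda>e. zer M = zer M)" by (intro dfn.eq dterm.zero)
  show ?thesis using 1 dfn.neg[OF 1] by (cases Q) simp_all
qed

text \<open>\<open>P\<close> takes the outer environment and the bound value separately, so that
  resolution against a quantified goal can find it by higher-order unification.\<close>

lemma dfn_ex:
  assumes "dfn M A (\<lambda>e. P (\<lambda>i. e (Suc i)) (e 0))"
  shows "dfn M A (\<lambda>e. \<exists>x. P e x)"
  using dfn.bex[OF assms] by simp

lemma dfn_all:
  assumes "dfn M A (\<lambda>e. P (\<lambda>i. e (Suc i)) (e 0))"
  shows "dfn M A (\<lambda>e. \<forall>x. P e x)"
proof -
  have "dfn M A (\<lambda>e. \<not> (\<exists>x. \<not> P e x))" by (intro dfn.neg dfn_ex assms)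
  then show ?thesis by simp
qed

lemma dterm_UNIV_const: "dterm M UNIV (\<lambda>e. c)"
  by (intro dterm.const) simp

text \<open>This and the binary version reduce an atom with arbitrary terms as arguments to the same
  atom with variables, so each notion is unfolded only once to show that it is definable.\<close>

lemma dfn_subst1:
  assumes "dfn M A (\<lambda>e. P (e 0))" "dterm M A f"
  shows "dfn M A (\<lambda>e. P (f e))"
  using dfn_subst[OF assms(1), of "\<lambda>_. f"] assms(2) by simp

lemma dfn_subst2:
  assumes "dfn M A (\<lambda>e. P (e 0) (e 1))" "dterm M A f" "dterm M A g"
  shows "dfn M A (\<lambda>e. P (f e) (g e))"
  using dfn_subst[OF assms(1), of "\<lambda>i. if i = 0 then f else g"] assms(2,3) by simp

lemma dterm_pair: "dterm M A f \<Longrightarrow> dterm M A g \<Longrightarrow> dterm M A (\<lambda>e. pair M (f e) (g e))"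
  unfolding pair_def by (intro dterm.intros)

lemmas dfn_intros = dfn.eq dfn.disj dfn.neg dfn_conj dfn_imp dfn_iff dfn_ex dfn_all dfn_const
  dterm.var dterm_UNIV_const dterm.zero dterm.suc dterm.add dterm.mul dterm_pair

section \<open>Definability of the arithmetical and syntactic notions\<close>

lemma dfn_lt: "dterm M UNIV f \<Longrightarrow> dterm M UNIV g \<Longrightarrow> dfn M UNIV (\<lambda>e. lt M (f e) (g e))"
  by (rule dfn_subst2) (unfold lt_def, intro dfn_intros)

lemma dfn_beta:
  assumes "dterm M UNIV f" "dterm M UNIV g" "dterm M UNIV h" "dterm M UNIV k"
  shows "dfn M UNIV (\<lambda>e. beta M (f e) (g e) (h e) (k e))"
proof -
  have "dfn M UNIV (\<lambda>e. beta M (e 0) (e 1) (e 2) (e 3))"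
    unfolding beta_def by (intro dfn_intros dfn_lt)
  from dfn_subst[OF this, of "case_nat f (case_nat g (case_nat h (\<lambda>_. k)))"] assms
  show ?thesis by (simp split: nat.split add: numeral_2_eq_2 numeral_3_eq_3)
qed

lemma dfn_pow2: "dterm M UNIV f \<Longrightarrow> dterm M UNIV g \<Longrightarrow> dfn M UNIV (\<lambda>e. pow2 M (f e) (g e))"
  by (rule dfn_subst2) (unfold pow2_def, intro dfn_intros dfn_lt dfn_beta)

lemma dfn_mem: "dterm M UNIV f \<Longrightarrow> dterm M UNIV g \<Longrightarrow> dfn M UNIV (\<lambda>e. mem M (f e) (g e))"
  by (rule dfn_subst2) (unfold mem_def, intro dfn_intros dfn_lt dfn_pow2)

lemma dfn_is_fun: "dterm M UNIV f \<Longrightarrow> dfn M UNIV (\<lambda>e. is_fun M (f e))"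
  by (rule dfn_subst1) (unfold is_fun_def, intro dfn_intros dfn_mem)

lemma dfn_seq_nth:
  "dterm M UNIV f \<Longrightarrow> dterm M UNIV g \<Longrightarrow> dfn M UNIV (\<lambda>e. seq_nth M c (f e) (g e))"
  by (rule dfn_subst2) (unfold seq_nth_def, intro dfn_intros dfn_mem)

lemmas code_defs = cVar_def cZero_def cSucc_def cPlus_def cTimes_def cEq_def cOr_def cNeg_def cEx_def

lemma dfn_is_term: "dterm M UNIV f \<Longrightarrow> dfn M UNIV (\<lambda>e. is_term M (f e))"
  by (rule dfn_subst1) (unfold is_term_def code_defs, intro dfn_intros dfn_mem)

lemma dfn_is_form: "dterm M UNIV f \<Longrightarrow> dfn M UNIV (\<lambda>e. is_form M (f e))"
  by (rule dfn_subst1) (unfold is_form_def code_defs, intro dfn_intros dfn_mem dfn_is_term)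

lemma dfn_occurs: "dterm M UNIV f \<Longrightarrow> dterm M UNIV g \<Longrightarrow> dfn M UNIV (\<lambda>e. occurs M (f e) (g e))"
  by (rule dfn_subst2) (unfold occurs_def code_defs, intro dfn_intros dfn_mem)

lemma dfn_free_in: "dterm M UNIV f \<Longrightarrow> dterm M UNIV g \<Longrightarrow> dfn M UNIV (\<lambda>e. free_in M (f e) (g e))"
  by (rule dfn_subst2) (unfold free_in_def code_defs, intro dfn_intros dfn_mem dfn_occurs)

lemma dfn_is_sent: "dterm M UNIV f \<Longrightarrow> dfn M UNIV (\<lambda>e. is_sent M (f e))"
  by (rule dfn_subst1) (unfold is_sent_def, intro dfn_intros dfn_is_form dfn_free_in)

lemmas dfn_rules = dfn_intros dfn_lt dfn_beta dfn_pow2 dfn_mem dfn_is_fun dfn_seq_nth dfn_is_form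
  dfn_free_in dfn_is_sent

text \<open>The schema in \<open>PA_model\<close> quantifies over environments, so parameters are
  free of charge once they sit in variables. From here on induction is used for predicates of HOL
  and no formula has to be written down.\<close>

lemma PA_induct:
  assumes PA: "PA_model M" and P: "dfn M UNIV (\<lambda>e. P (e 0))"
    and zero: "P (zer M)" and step: "\<And>x. P x \<Longrightarrow> P (suc M x)"
  shows "P x"
proof -
  obtain A where A: "finite A" "dfn M A (\<lambda>e. P (e 0))" using dfn_finite[OF P] by blast
  obtain xs where xs: "set xs = A" using A(1) finite_list by blast
  \<comment> \<open>Past the end of the list \<open>x\<close> is only a default value that makes the
    enumeration of parameters total.\<close>
  define \<rho> where "\<rho> i = (if i < length xs then xs ! i else x)" for i
  have "A \<subseteq> range \<rho>" unfolding xs[symmetric] set_conv_nth by (auto simp: \<rho>_def image_iff)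
  with A(2) have "dfn M (range \<rho>) (\<lambda>e. P (e 0))" by (auto elim: dfn_mono)
  \<comment> \<open>Variables divisible by 3 hold arguments, those with remainder 1 hold parameters,
    and those with remainder 2 are left for quantifiers.\<close>
  moreover have "infinite (- (range (\<lambda>i::nat. 3 * i) \<union> range (\<lambda>i. 3 * i + 1)))"
  proof -
    have "range (\<lambda>i::nat. 3 * i + 2) \<subseteq> - (range (\<lambda>i. 3 * i) \<union> range (\<lambda>i. 3 * i + 1))"
      by (auto, presburger+)
    moreover have "infinite (range (\<lambda>i::nat. 3 * i + 2))" by (subst finite_image_iff) (auto simp: inj_on_def)
    ultimately show ?thesis using finite_subset by blast
  qed
  ultimately obtain \<phi> where
    \<phi>: "\<And>e. (\<forall>j. e (3 * j + 1) = \<rho> j) \<Longrightarrow> sat M e \<phi> \<longleftrightarrow> P (e (3 * 0))"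
    using dfn_fm[of M \<rho> "\<lambda>e. P (e 0)" "\<lambda>i. 3 * i" "\<lambda>i. 3 * i + 1"] by blast
  \<comment> \<open>Division by 3 sends variable \<open>3 * j + 1\<close> to parameter
    \<open>j\<close>; the argument in variable 0 is overwritten by the value of interest.\<close>
  define e where "e k = \<rho> (k div 3)" for k :: nat
  have "Suc (3 * j) div 3 = j" for j :: nat by presburger
  then have *: "sat M (e(0 := y)) \<phi> \<longleftrightarrow> P y" for y
    by (subst \<phi>) (auto simp: e_def)
  show ?thesis using PA zero step unfolding PA_model_def *[symmetric] by blast
qed

section \<open>Arithmetic in a model of PA\<close>

locale pa =
  fixes M :: "'a arith"
  assumes PA: "PA_model M"
begin

abbreviation zero_M ("\<zero>") where "\<zero> \<equiv> zer M"
abbreviation S where "S \<equiv> suc M"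
abbreviation one_M ("\<one>") where "\<one> \<equiv> S \<zero>"
abbreviation add_M (infixl "\<oplus>" 65) where "x \<oplus> y \<equiv> add M x y"
abbreviation mul_M (infixl "\<otimes>" 70) where "x \<otimes> y \<equiv> mul M x y"
abbreviation lt_M (infix "\<prec>" 50) where "x \<prec> y \<equiv> lt M x y"

definition le :: "'a \<Rightarrow> 'a \<Rightarrow> bool" (infix "\<preceq>" 50) where
  "x \<preceq> y \<longleftrightarrow> (\<exists>z. x \<oplus> z = y)"

abbreviation dfn1 where "dfn1 P \<equiv> dfn M UNIV (\<lambda>e. P (e 0))"

lemma ind: "dfn1 P \<Longrightarrow> P \<zero> \<Longrightarrow> (\<And>x. P x \<Longrightarrow> P (S x)) \<Longrightarrow> P x"
  by (rule PA_induct[OF PA])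

lemma S_not_zero [simp]: "S x \<noteq> \<zero>" "\<zero> \<noteq> S x"
  and S_inj [simp]: "S x = S y \<longleftrightarrow> x = y"
  and add_zero: "x \<oplus> \<zero> = x"
  and add_S: "x \<oplus> S y = S (x \<oplus> y)"
  and mul_zero: "x \<otimes> \<zero> = \<zero>"
  and mul_S: "x \<otimes> S y = x \<otimes> y \<oplus> x"
  using PA unfolding PA_model_def by metis+

lemma zero_add: "\<zero> \<oplus> x = x"
  by (rule ind[where P = "\<lambda>x. \<zero> \<oplus> x = x"]) (intro dfn_rules, simp_all add: add_zero add_S)

lemma S_add: "S x \<oplus> y = S (x \<oplus> y)"
  by (rule ind[where P = "\<lambda>y. S x \<oplus> y = S (x \<oplus> y)"]) (intro dfn_rules, simp_all add: add_zero add_S)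

lemma add_comm: "x \<oplus> y = y \<oplus> x"
  by (rule ind[where P = "\<lambda>y. x \<oplus> y = y \<oplus> x"])
    (intro dfn_rules, simp_all add: add_zero add_S zero_add S_add)

lemma add_assoc: "x \<oplus> y \<oplus> z = x \<oplus> (y \<oplus> z)"
  by (rule ind[where P = "\<lambda>z. x \<oplus> y \<oplus> z = x \<oplus> (y \<oplus> z)"])
    (intro dfn_rules, simp_all add: add_zero add_S)

lemma add_left_comm: "x \<oplus> (y \<oplus> z) = y \<oplus> (x \<oplus> z)"
  by (metis add_comm add_assoc)

lemmas add_ac = add_assoc add_comm add_left_comm

lemma zero_mul: "\<zero> \<otimes> x = \<zero>"
  by (rule ind[where P = "\<lambda>x. \<zero> \<otimes> x = \<zero>"]) (intro dfn_rules, simp_all add: mul_zero mul_S add_zero)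

lemma S_mul: "S x \<otimes> y = x \<otimes> y \<oplus> y"
  by (rule ind[where P = "\<lambda>y. S x \<otimes> y = x \<otimes> y \<oplus> y"])
    (intro dfn_rules, simp_all add: mul_zero mul_S add_zero add_S S_add add_ac)

lemma mul_comm: "x \<otimes> y = y \<otimes> x"
  by (rule ind[where P = "\<lambda>y. x \<otimes> y = y \<otimes> x"])
    (intro dfn_rules, simp_all add: mul_zero mul_S zero_mul S_mul)

lemma distrib_right: "(x \<oplus> y) \<otimes> z = x \<otimes> z \<oplus> y \<otimes> z"
  by (rule ind[where P = "\<lambda>z. (x \<oplus> y) \<otimes> z = x \<otimes> z \<oplus> y \<otimes> z"])
    (intro dfn_rules, simp_all add: mul_zero mul_S add_zero add_ac)

lemma mul_assoc: "x \<otimes> y \<otimes> z = x \<otimes> (y \<otimes> z)"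
proof (rule ind[where P = "\<lambda>x. x \<otimes> y \<otimes> z = x \<otimes> (y \<otimes> z)"])
  show "dfn1 (\<lambda>x. x \<otimes> y \<otimes> z = x \<otimes> (y \<otimes> z))" by (intro dfn_rules)
qed (simp_all add: zero_mul S_mul distrib_right)

lemma distrib_left: "z \<otimes> (x \<oplus> y) = z \<otimes> x \<oplus> z \<otimes> y"
  by (metis distrib_right mul_comm)

lemma mul_left_comm: "x \<otimes> (y \<otimes> z) = y \<otimes> (x \<otimes> z)"
  by (metis mul_comm mul_assoc)

lemmas semiring = add_ac mul_assoc mul_comm mul_left_comm distrib_right distrib_left

declare add_zero [simp] zero_add [simp] mul_zero [simp] zero_mul [simp]

lemma mul_one [simp]: "x \<otimes> \<one> = x" "\<one> \<otimes> x = x"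
  by (simp_all add: mul_S S_mul)

lemma S_eq: "S x = x \<oplus> \<one>"
  by (simp add: add_S)

lemma add_right_cancel [simp]: "x \<oplus> z = y \<oplus> z \<longleftrightarrow> x = y"
  by (rule ind[where P = "\<lambda>z. x \<oplus> z = y \<oplus> z \<longleftrightarrow> x = y"]) (intro dfn_rules, simp_all add: add_S)

lemma add_left_cancel [simp]: "z \<oplus> x = z \<oplus> y \<longleftrightarrow> x = y"
  by (metis add_comm add_right_cancel)

lemma zero_or_S: "x = \<zero> \<or> (\<exists>y. x = S y)"
  by (rule ind[where P = "\<lambda>x. x = \<zero> \<or> (\<exists>y. x = S y)"]) (intro dfn_rules, simp_all)

lemma add_eq_zero [simp]: "x \<oplus> y = \<zero> \<longleftrightarrow> x = \<zero> \<and> y = \<zero>"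
  using zero_or_S[of x] zero_or_S[of y] by (auto simp: add_S)

section \<open>The order of the model\<close>

lemma lt_iff_S_le: "x \<prec> y \<longleftrightarrow> S x \<preceq> y"
  by (simp add: lt_def le_def S_add add_S)

lemma le_total: "x \<preceq> y \<or> y \<preceq> x"
proof (rule ind[where P = "\<lambda>x. x \<preceq> y \<or> y \<preceq> x"])
  show "dfn1 (\<lambda>x. x \<preceq> y \<or> y \<preceq> x)" unfolding le_def by (intro dfn_rules)
  show "\<zero> \<preceq> y \<or> y \<preceq> \<zero>" by (simp add: le_def)
  fix x assume "x \<preceq> y \<or> y \<preceq> x"
  then show "S x \<preceq> y \<or> y \<preceq> S x"
  proof
    assume "x \<preceq> y"
    then obtain z where z: "x \<oplus> z = y" by (auto simp: le_def)
    show ?thesis using zero_or_S[of z] z by (auto simp: le_def S_add add_S) (metis S_eq)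
  next
    assume "y \<preceq> x"
    then show ?thesis by (auto simp: le_def) (metis add_S)
  qed
qed

sublocale O: linorder le "lt M"
proof
  show refl: "x \<preceq> x" for x unfolding le_def by (metis add_zero)
  show anti: "x \<preceq> y \<Longrightarrow> y \<preceq> x \<Longrightarrow> x = y" for x y
    unfolding le_def by (metis add_assoc add_eq_zero add_left_cancel add_zero)
  show "x \<preceq> y \<Longrightarrow> y \<preceq> z \<Longrightarrow> x \<preceq> z" for x y z
    unfolding le_def by (metis add_assoc)
  show "x \<preceq> y \<or> y \<preceq> x" for x y by (rule le_total)
  show "x \<prec> y \<longleftrightarrow> x \<preceq> y \<and> \<not> y \<preceq> x" for x y
  proof -
    have "x \<prec> y \<longleftrightarrow> x \<preceq> y \<and> x \<noteq> y"
      unfolding lt_def le_def by (metis add_left_cancel add_zero zero_or_S S_not_zero(1))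
    then show ?thesis using anti refl by blast
  qed
qed

lemma zero_le [simp]: "\<zero> \<preceq> x"
  by (auto simp: le_def)

lemma not_lt_zero [simp]: "\<not> x \<prec> \<zero>"
  by (simp add: O.not_less)

lemma le_zero [simp]: "x \<preceq> \<zero> \<longleftrightarrow> x = \<zero>"
  by (simp add: O.antisym_conv)

lemma zero_lt_iff: "\<zero> \<prec> x \<longleftrightarrow> x \<noteq> \<zero>"
  by (metis O.neqE not_lt_zero O.less_irrefl)

lemma zero_lt_S [simp]: "\<zero> \<prec> S x"
  by (simp add: zero_lt_iff)

lemma S_le_S [simp]: "S x \<preceq> S y \<longleftrightarrow> x \<preceq> y"
  by (simp add: le_def S_add)

lemma lt_S: "x \<prec> S y \<longleftrightarrow> x \<preceq> y"
  by (simp add: lt_iff_S_le)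

lemma lt_S_self [simp]: "x \<prec> S x"
  by (simp add: lt_S)

lemma le_add1 [simp]: "x \<preceq> x \<oplus> y" and le_add2 [simp]: "x \<preceq> y \<oplus> x"
  unfolding le_def by (metis add_comm)+

lemma add_le_cancel [simp]: "x \<oplus> z \<preceq> y \<oplus> z \<longleftrightarrow> x \<preceq> y" "z \<oplus> x \<preceq> z \<oplus> y \<longleftrightarrow> x \<preceq> y"
proof -
  show "z \<oplus> x \<preceq> z \<oplus> y \<longleftrightarrow> x \<preceq> y" by (simp add: le_def add_assoc)
  then show "x \<oplus> z \<preceq> y \<oplus> z \<longleftrightarrow> x \<preceq> y" by (simp add: add_comm)
qed

lemma add_lt_cancel [simp]: "x \<oplus> z \<prec> y \<oplus> z \<longleftrightarrow> x \<prec> y" "z \<oplus> x \<prec> z \<oplus> y \<longleftrightarrow> x \<prec> y"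
  by (simp_all add: O.less_le)

lemma add_le_mono: "x \<preceq> y \<Longrightarrow> z \<preceq> w \<Longrightarrow> x \<oplus> z \<preceq> y \<oplus> w"
  by (meson add_le_cancel O.order_trans)

lemma mul_le_mono: "x \<preceq> y \<Longrightarrow> x \<otimes> z \<preceq> y \<otimes> z"
  by (auto simp: le_def distrib_right)

lemma mul_lt_mono: "x \<prec> y \<Longrightarrow> z \<noteq> \<zero> \<Longrightarrow> x \<otimes> z \<prec> y \<otimes> z"
proof -
  assume "x \<prec> y" "z \<noteq> \<zero>"
  then have "S x \<otimes> z \<preceq> y \<otimes> z" by (intro mul_le_mono) (simp add: lt_iff_S_le)
  moreover have "x \<otimes> z \<oplus> \<zero> \<prec> x \<otimes> z \<oplus> z" using \<open>z \<noteq> \<zero>\<close> unfolding add_lt_cancel by (simp add: zero_lt_iff)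
  ultimately show ?thesis by (simp add: S_mul)
qed

lemma mul_right_cancel: "z \<noteq> \<zero> \<Longrightarrow> x \<otimes> z = y \<otimes> z \<longleftrightarrow> x = y"
  by (metis O.less_irrefl O.neqE mul_lt_mono)

lemma mul_lt_cancel: "z \<noteq> \<zero> \<Longrightarrow> x \<otimes> z \<prec> y \<otimes> z \<longleftrightarrow> x \<prec> y"
  by (metis O.less_asym O.neqE mul_lt_mono)

lemma dfn_le: "dterm M UNIV f \<Longrightarrow> dterm M UNIV g \<Longrightarrow> dfn M UNIV (\<lambda>e. f e \<preceq> g e)"
  by (rule dfn_subst2) (unfold le_def, intro dfn_rules)

lemma less_ind:
  assumes P: "dfn1 P" and step: "\<And>x. (\<And>y. y \<prec> x \<Longrightarrow> P y) \<Longrightarrow> P x"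
  shows "P x"
proof -
  have "\<forall>y. y \<prec> x \<longrightarrow> P y"
  proof (rule ind[where P = "\<lambda>x. \<forall>y. y \<prec> x \<longrightarrow> P y"])
    show "dfn1 (\<lambda>x. \<forall>y. y \<prec> x \<longrightarrow> P y)" by (intro dfn_rules dfn_subst1[OF P])
    fix x assume IH: "\<forall>y. y \<prec> x \<longrightarrow> P y"
    then show "\<forall>y. y \<prec> S x \<longrightarrow> P y" using step by (metis lt_S O.le_less)
  qed simp
  then show ?thesis using step by blast
qed

section \<open>Division with remainder\<close>

lemma div_ex:
  assumes "m \<noteq> \<zero>"
  obtains q r where "r \<prec> m" "u = q \<otimes> m \<oplus> r"
proof -
  have "\<exists>q r. r \<prec> m \<and> u = q \<otimes> m \<oplus> r"
  proof (rule ind[where P = "\<lambda>u. \<exists>q r. r \<prec> m \<and> u = q \<otimes> m \<oplus> r"])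
    show "dfn1 (\<lambda>u. \<exists>q r. r \<prec> m \<and> u = q \<otimes> m \<oplus> r)" by (intro dfn_rules)
    show "\<exists>q r. r \<prec> m \<and> \<zero> = q \<otimes> m \<oplus> r" using assms by (auto intro!: exI[of _ "\<zero>"] simp: zero_lt_iff)
    fix u assume "\<exists>q r. r \<prec> m \<and> u = q \<otimes> m \<oplus> r"
    then obtain q r where "r \<prec> m" "u = q \<otimes> m \<oplus> r" by blast
    then have *: "S r \<preceq> m" "S u = q \<otimes> m \<oplus> S r" by (simp_all add: lt_iff_S_le add_S)
    show "\<exists>q r. r \<prec> m \<and> S u = q \<otimes> m \<oplus> r"
    proof (cases "S r = m")
      case True
      then have "S u = S q \<otimes> m \<oplus> \<zero>" using * by (simp add: S_mul)
      then show ?thesis using assms zero_lt_iff by blast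
    next
      case False
      then show ?thesis using * by (metis O.le_less)
    qed
  qed
  then show thesis using that by blast
qed

lemma div_unique_less: "r' \<prec> m \<Longrightarrow> q \<otimes> m \<oplus> r = q' \<otimes> m \<oplus> r' \<Longrightarrow> \<not> q' \<prec> q"
proof
  assume "r' \<prec> m" "q \<otimes> m \<oplus> r = q' \<otimes> m \<oplus> r'" "q' \<prec> q"
  then have "S q' \<otimes> m \<preceq> q \<otimes> m" by (intro mul_le_mono) (simp add: lt_iff_S_le)
  also have "\<dots> \<preceq> q \<otimes> m \<oplus> r" by simp
  also have "\<dots> = q' \<otimes> m \<oplus> r'" by fact
  also have "\<dots> \<prec> q' \<otimes> m \<oplus> m" using \<open>r' \<prec> m\<close> by simp
  also have "\<dots> = S q' \<otimes> m" by (simp add: S_mul)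
  finally show False by simp
qed

lemma div_unique:
  assumes "r \<prec> m" "r' \<prec> m" "q \<otimes> m \<oplus> r = q' \<otimes> m \<oplus> r'"
  shows "q = q' \<and> r = r'"
proof -
  have "q = q'" using div_unique_less[OF assms(2,3)] div_unique_less[OF assms(1) assms(3)[symmetric]]
    by (meson O.neqE)
  then show ?thesis using assms(3) by simp
qed

end

section \<open>Goedel's beta function and powers of two\<close>

context pa begin

text \<open>There are no negative elements, so multiples of the modulus are added on both
  sides.\<close>

definition cong :: "'a \<Rightarrow> 'a \<Rightarrow> 'a \<Rightarrow> bool" where
  "cong m a b \<longleftrightarrow> (\<exists>p q. a \<oplus> p \<otimes> m = b \<oplus> q \<otimes> m)"

lemma cong_refl [simp]: "cong m a a"
  by (auto simp: cong_def)

lemma cong_sym: "cong m a b \<Longrightarrow> cong m b a"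
  unfolding cong_def by (elim exE) (metis (no_types))

lemma cong_trans [trans]: "cong m a b \<Longrightarrow> cong m b c \<Longrightarrow> cong m a c"
proof -
  assume "cong m a b" "cong m b c"
  then obtain p q p' q' where 1: "a \<oplus> p \<otimes> m = b \<oplus> q \<otimes> m" and 2: "b \<oplus> p' \<otimes> m = c \<oplus> q' \<otimes> m"
    by (auto simp: cong_def)
  have "a \<oplus> (p \<oplus> p') \<otimes> m = (a \<oplus> p \<otimes> m) \<oplus> p' \<otimes> m" by (simp add: semiring)
  also have "\<dots> = (b \<oplus> p' \<otimes> m) \<oplus> q \<otimes> m" unfolding 1 by (simp add: semiring)
  also have "\<dots> = c \<oplus> (q' \<oplus> q) \<otimes> m" unfolding 2 by (simp add: semiring)
  finally show ?thesis by (auto simp: cong_def)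
qed

lemma cong_add: "cong m a b \<Longrightarrow> cong m c d \<Longrightarrow> cong m (a \<oplus> c) (b \<oplus> d)"
proof -
  assume "cong m a b" "cong m c d"
  then obtain p q p' q' where 1: "a \<oplus> p \<otimes> m = b \<oplus> q \<otimes> m" and 2: "c \<oplus> p' \<otimes> m = d \<oplus> q' \<otimes> m"
    by (auto simp: cong_def)
  have "(a \<oplus> c) \<oplus> (p \<oplus> p') \<otimes> m = (a \<oplus> p \<otimes> m) \<oplus> (c \<oplus> p' \<otimes> m)" by (simp add: semiring)
  also have "\<dots> = (b \<oplus> d) \<oplus> (q \<oplus> q') \<otimes> m" unfolding 1 2 by (simp add: semiring)
  finally show ?thesis by (auto simp: cong_def)
qed

lemma cong_mul: "cong m a b \<Longrightarrow> cong m (a \<otimes> x) (b \<otimes> x)"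
proof -
  assume "cong m a b"
  then obtain p q where 1: "a \<oplus> p \<otimes> m = b \<oplus> q \<otimes> m" by (auto simp: cong_def)
  have "a \<otimes> x \<oplus> (p \<otimes> x) \<otimes> m = (a \<oplus> p \<otimes> m) \<otimes> x" by (simp add: semiring)
  also have "\<dots> = b \<otimes> x \<oplus> (q \<otimes> x) \<otimes> m" unfolding 1 by (simp add: semiring)
  finally show ?thesis by (auto simp: cong_def)
qed

lemma cong_cancel: "cong m (a \<oplus> c) (b \<oplus> c) \<Longrightarrow> cong m a b"
proof -
  assume "cong m (a \<oplus> c) (b \<oplus> c)"
  then obtain p q where "(a \<oplus> c) \<oplus> p \<otimes> m = (b \<oplus> c) \<oplus> q \<otimes> m" by (auto simp: cong_def)
  then have "c \<oplus> (a \<oplus> p \<otimes> m) = c \<oplus> (b \<oplus> q \<otimes> m)" by (simp only: add_ac)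
  then show ?thesis unfolding add_left_cancel by (auto simp: cong_def)
qed

lemma cong_multiple [simp]: "cong m (x \<otimes> m) \<zero>" "cong m (m \<otimes> x) \<zero>" "cong m m \<zero>"
proof -
  show *: "cong m (x \<otimes> m) \<zero>" for x unfolding cong_def by (rule exI[of _ "\<zero>"], rule exI[of _ x]) simp
  show "cong m (m \<otimes> x) \<zero>" using *[of x] by (simp only: mul_comm)
  show "cong m m \<zero>" using *[of "\<one>"] by simp
qed

text \<open>Coprimality to \<open>m\<close>, taken as invertibility: in this form it passes directly
  to products and factors, and the inverse is the multiplier wanted in the Chinese remainder
  step.\<close>

definition unit :: "'a \<Rightarrow> 'a \<Rightarrow> bool" where
  "unit m w \<longleftrightarrow> (\<exists>s. cong m (w \<otimes> s) \<one>)"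

lemma unit_one [simp]: "unit m \<one>"
  by (auto simp: unit_def intro: exI[of _ "\<one>"])

lemma unit_mul: "unit m w \<Longrightarrow> unit m w' \<Longrightarrow> unit m (w \<otimes> w')"
proof -
  assume "unit m w" "unit m w'"
  then obtain s s' where s: "cong m (w \<otimes> s) \<one>" "cong m (w' \<otimes> s') \<one>" by (auto simp: unit_def)
  have "cong m (w \<otimes> s \<otimes> (w' \<otimes> s')) (w' \<otimes> s')" using cong_mul[OF s(1)] by simp
  then have "cong m (w \<otimes> s \<otimes> (w' \<otimes> s')) \<one>" using s(2) cong_trans by blast
  moreover have "w \<otimes> s \<otimes> (w' \<otimes> s') = w \<otimes> w' \<otimes> (s \<otimes> s')" by (simp add: semiring)
  ultimately show ?thesis unfolding unit_def by metis
qed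

lemma unit_factor: "unit m (x \<otimes> y) \<Longrightarrow> unit m x"
  unfolding unit_def mul_assoc by blast

lemma unit_neg:
  assumes "cong m (x \<oplus> y) \<zero>" "unit m y" "m \<noteq> \<zero>"
  shows "unit m x"
proof -
  \<comment> \<open>\<open>X\<close> is m - 1 and acts as -1: as \<open>x\<close> is congruent to
    the negative of \<open>y\<close>, an inverse of \<open>x\<close> is
    \<open>X \<otimes> s\<close>.\<close>
  obtain X where X: "m = S X" using zero_or_S assms(3) by blast
  obtain s where s: "cong m (y \<otimes> s) \<one>" using assms(2) by (auto simp: unit_def)
  have "cong m (x \<otimes> (X \<otimes> s) \<oplus> y \<otimes> (X \<otimes> s)) \<zero>"
    using cong_mul[OF assms(1)] by (simp add: distrib_right)
  also have "cong m \<zero> (m \<otimes> (y \<otimes> s))" by (rule cong_sym) simp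
  also have "m \<otimes> (y \<otimes> s) = y \<otimes> s \<oplus> y \<otimes> (X \<otimes> s)" by (simp add: X S_mul mul_S semiring)
  finally have "cong m (x \<otimes> (X \<otimes> s)) (y \<otimes> s)" by (rule cong_cancel)
  then show ?thesis using s cong_trans unfolding unit_def by blast
qed

section \<open>The Chinese remainder theorem for the moduli of the beta function\<close>

abbreviation modulus where "modulus v i \<equiv> S (S i \<otimes> v)"

lemma beta_iff_cong: "r \<prec> modulus v i \<Longrightarrow> beta M u v i r \<longleftrightarrow> cong (modulus v i) u r"
proof
  assume "r \<prec> modulus v i" "cong (modulus v i) u r"
  obtain q r' where q: "r' \<prec> modulus v i" "u = q \<otimes> modulus v i \<oplus> r'" by (rule div_ex[of "modulus v i" u]) simp_all
  have "cong (modulus v i) (\<zero> \<oplus> r') (q \<otimes> modulus v i \<oplus> r')" by (intro cong_add cong_sym[OF cong_multiple(1)]) simp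
  then have "cong (modulus v i) r' u" by (simp only: zero_add flip: q(2))
  then have "cong (modulus v i) r' r" using \<open>cong _ u r\<close> cong_trans by blast
  then obtain a b where "r' \<oplus> a \<otimes> modulus v i = r \<oplus> b \<otimes> modulus v i" by (auto simp only: cong_def)
  then have "a \<otimes> modulus v i \<oplus> r' = b \<otimes> modulus v i \<oplus> r" by (simp only: add_comm)
  then have "r' = r" using div_unique[OF q(1) \<open>r \<prec> _\<close>] by blast
  then show "beta M u v i r" unfolding beta_def using q by blast
next
  assume "r \<prec> modulus v i" "beta M u v i r"
  then obtain q where q: "u = q \<otimes> modulus v i \<oplus> r" by (auto simp only: beta_def)
  have "cong (modulus v i) (q \<otimes> modulus v i \<oplus> r) (\<zero> \<oplus> r)" by (intro cong_add cong_multiple(1)) simp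
  then show "cong (modulus v i) u r" by (simp only: zero_add flip: q)
qed

lemma beta_unique: "beta M u v i r \<Longrightarrow> beta M u v i r' \<Longrightarrow> r = r'"
  unfolding beta_def by (elim conjE exE) (metis (no_types) div_unique)

lemma beta_le: "beta M u v i r \<Longrightarrow> r \<preceq> u"
  unfolding beta_def by (elim conjE exE) (simp only: le_add2)

text \<open>A substitute for a factorial, grown by the factor \<open>S n\<close> at each step of the
  induction. The bound \<open>B\<close> is met at the start by \<open>S B\<close> and only
  improves.\<close>

lemma common_multiple:
  "\<exists>v. v \<noteq> \<zero> \<and> B \<preceq> v \<and> (\<forall>d. d \<noteq> \<zero> \<and> d \<preceq> n \<longrightarrow> (\<exists>f. v = d \<otimes> f))"
proof (rule ind[where P = "\<lambda>n. \<exists>v. v \<noteq> \<zero> \<and> B \<preceq> v \<and> (\<forall>d. d \<noteq> \<zero> \<and> d \<preceq> n \<longrightarrow> (\<exists>f. v = d \<otimes> f))"])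
  show "dfn1 (\<lambda>n. \<exists>v. v \<noteq> \<zero> \<and> B \<preceq> v \<and> (\<forall>d. d \<noteq> \<zero> \<and> d \<preceq> n \<longrightarrow> (\<exists>f. v = d \<otimes> f)))"
    by (intro dfn_rules dfn_le)
  show "\<exists>v. v \<noteq> \<zero> \<and> B \<preceq> v \<and> (\<forall>d. d \<noteq> \<zero> \<and> d \<preceq> \<zero> \<longrightarrow> (\<exists>f. v = d \<otimes> f))"
    by (rule exI[of _ "S B"]) (simp add: O.less_imp_le)
  fix n assume "\<exists>v. v \<noteq> \<zero> \<and> B \<preceq> v \<and> (\<forall>d. d \<noteq> \<zero> \<and> d \<preceq> n \<longrightarrow> (\<exists>f. v = d \<otimes> f))"
  then obtain v where v: "v \<noteq> \<zero>" "B \<preceq> v" "\<And>d. d \<noteq> \<zero> \<Longrightarrow> d \<preceq> n \<Longrightarrow> \<exists>f. v = d \<otimes> f" by blast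
  have "v \<otimes> S n \<noteq> \<zero>" "B \<preceq> v \<otimes> S n"
    using v(1,2) le_add2[of v "v \<otimes> n"] O.order_trans by (auto simp: mul_S)
  moreover have "\<exists>f. v \<otimes> S n = d \<otimes> f" if "d \<noteq> \<zero>" "d \<preceq> S n" for d
  proof (cases "d = S n")
    case True
    then show ?thesis by (metis mul_comm)
  next
    case False
    then have "d \<preceq> n" using that(2) by (metis O.le_less lt_S)
    then show ?thesis using v(3) that(1) by (metis mul_assoc)
  qed
  ultimately show "\<exists>v. v \<noteq> \<zero> \<and> B \<preceq> v \<and> (\<forall>d. d \<noteq> \<zero> \<and> d \<preceq> S n \<longrightarrow> (\<exists>f. v = d \<otimes> f))" by blast
qed

text \<open>Two moduli differ by d times \<open>v\<close> with d = j - k. Here \<open>v\<close> is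
  invertible, because \<open>S j \<otimes> v\<close> is -1 modulo the j-th modulus, and so is its
  divisor d. Hence the k-th modulus is the negative of a unit.\<close>

lemma unit_modulus:
  assumes v: "v \<noteq> \<zero>" "\<And>d. d \<noteq> \<zero> \<Longrightarrow> d \<preceq> n \<Longrightarrow> \<exists>f. v = d \<otimes> f" and "k \<prec> j" "j \<preceq> n"
  shows "unit (modulus v j) (modulus v k)"
proof -
  obtain d where d: "j = k \<oplus> d" "d \<noteq> \<zero>" using \<open>k \<prec> j\<close> unfolding lt_def by (metis S_not_zero(1))
  then have "d \<preceq> n" using \<open>j \<preceq> n\<close> O.order_trans[OF le_add2] by blast
  then obtain f where f: "v = d \<otimes> f" using v(2) d(2) by blast
  have "S j \<otimes> v \<oplus> \<one> = modulus v j" by (simp add: add_S)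
  then have "cong (modulus v j) (S j \<otimes> v \<oplus> \<one>) \<zero>" by simp
  then have "unit (modulus v j) (S j \<otimes> v)" by (rule unit_neg) simp_all
  then have uv: "unit (modulus v j) v" using unit_factor mul_comm by metis
  then have "unit (modulus v j) d" using f unit_factor by metis
  then have "unit (modulus v j) (d \<otimes> v)" using uv by (rule unit_mul)
  moreover have "modulus v k \<oplus> d \<otimes> v = modulus v j" by (simp add: d S_mul S_add mul_S add_S semiring)
  then have "cong (modulus v j) (modulus v k \<oplus> d \<otimes> v) \<zero>" by simp
  ultimately show ?thesis by (auto intro: unit_neg)
qed

lemma dfn_cong:
  assumes "dterm M UNIV f" "dterm M UNIV g" "dterm M UNIV h"
  shows "dfn M UNIV (\<lambda>e. cong (f e) (g e) (h e))"
proof -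
  have "dfn M UNIV (\<lambda>e. cong (e 0) (e 1) (e 2))" unfolding cong_def by (intro dfn_rules)
  from dfn_subst[OF this, of "case_nat f (case_nat g (\<lambda>_. h))"] assms
  show ?thesis by (simp split: nat.split add: numeral_2_eq_2)
qed

text \<open>The \<open>w\<close> in mind is the product of the first \<open>k\<close> moduli. As
  sequences cannot yet be coded, it is described by the two properties that \<open>beta_code\<close>
  uses, and these can be proved by induction.\<close>

lemma coprime_product:
  assumes v: "v \<noteq> \<zero>" "\<And>d. d \<noteq> \<zero> \<Longrightarrow> d \<preceq> n \<Longrightarrow> \<exists>f. v = d \<otimes> f"
  shows "\<exists>w. (\<forall>i. i \<prec> k \<longrightarrow> (\<exists>f. w = modulus v i \<otimes> f)) \<and> (\<forall>j. k \<preceq> j \<and> j \<preceq> n \<longrightarrow> unit (modulus v j) w)"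
proof (rule ind[where P = "\<lambda>k. \<exists>w. (\<forall>i. i \<prec> k \<longrightarrow> (\<exists>f. w = modulus v i \<otimes> f)) \<and>
    (\<forall>j. k \<preceq> j \<and> j \<preceq> n \<longrightarrow> unit (modulus v j) w)"])
  show "dfn1 (\<lambda>k. \<exists>w. (\<forall>i. i \<prec> k \<longrightarrow> (\<exists>f. w = modulus v i \<otimes> f)) \<and>
    (\<forall>j. k \<preceq> j \<and> j \<preceq> n \<longrightarrow> unit (modulus v j) w))"
    unfolding unit_def by (intro dfn_rules dfn_le dfn_cong)
  show "\<exists>w. (\<forall>i. i \<prec> \<zero> \<longrightarrow> (\<exists>f. w = modulus v i \<otimes> f)) \<and> (\<forall>j. \<zero> \<preceq> j \<and> j \<preceq> n \<longrightarrow> unit (modulus v j) w)"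
    by (rule exI[of _ "\<one>"]) simp
  fix k assume "\<exists>w. (\<forall>i. i \<prec> k \<longrightarrow> (\<exists>f. w = modulus v i \<otimes> f)) \<and>
    (\<forall>j. k \<preceq> j \<and> j \<preceq> n \<longrightarrow> unit (modulus v j) w)"
  then obtain w where w: "\<And>i. i \<prec> k \<Longrightarrow> \<exists>f. w = modulus v i \<otimes> f"
    "\<And>j. k \<preceq> j \<Longrightarrow> j \<preceq> n \<Longrightarrow> unit (modulus v j) w" by blast
  have "\<exists>f. w \<otimes> modulus v k = modulus v i \<otimes> f" if "i \<prec> S k" for i
    using that w(1) by (metis O.le_less lt_S mul_assoc mul_comm)
  moreover have "unit (modulus v j) (w \<otimes> modulus v k)" if "S k \<preceq> j" "j \<preceq> n" for j
    using that w(2) unit_modulus[OF v] by (intro unit_mul) (auto simp: lt_iff_S_le[symmetric] O.less_imp_le)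
  ultimately show "\<exists>w. (\<forall>i. i \<prec> S k \<longrightarrow> (\<exists>f. w = modulus v i \<otimes> f)) \<and>
    (\<forall>j. S k \<preceq> j \<and> j \<preceq> n \<longrightarrow> unit (modulus v j) w)" by blast
qed

text \<open>\<open>v\<close> is chosen once, at least \<open>B\<close>, so that every modulus
  exceeds every value; then \<open>u\<close> is corrected for one index after another. The values
  come from a definable relation, which allows \<open>beta\<close> itself as a source.\<close>

lemma beta_code:
  assumes G: "dfn M UNIV (\<lambda>e. G (e 0) (e 1))"
    and bd: "\<And>i. i \<preceq> n \<Longrightarrow> \<exists>g. G i g \<and> g \<preceq> B"
  shows "\<exists>u v. \<forall>i. i \<preceq> n \<longrightarrow> (\<exists>g. G i g \<and> beta M u v i g)"
proof -
  obtain v where v: "v \<noteq> \<zero>" "B \<preceq> v" "\<And>d. d \<noteq> \<zero> \<Longrightarrow> d \<preceq> n \<Longrightarrow> \<exists>f. v = d \<otimes> f"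
    using common_multiple[of B n] by blast
  have lt_modulus: "g \<prec> modulus v i" if "g \<preceq> v" for g i
    using that le_add2[of v "i \<otimes> v"] O.order_trans by (auto simp: lt_S S_mul)
  have "k \<preceq> S n \<longrightarrow> (\<exists>u. \<forall>i. i \<prec> k \<longrightarrow> (\<exists>g. G i g \<and> beta M u v i g))" for k
  proof (rule ind[where P = "\<lambda>k. k \<preceq> S n \<longrightarrow> (\<exists>u. \<forall>i. i \<prec> k \<longrightarrow> (\<exists>g. G i g \<and> beta M u v i g))"])
    show "dfn1 (\<lambda>k. k \<preceq> S n \<longrightarrow> (\<exists>u. \<forall>i. i \<prec> k \<longrightarrow> (\<exists>g. G i g \<and> beta M u v i g)))"
      by (intro dfn_rules dfn_le dfn_subst2[OF G])
    fix k assume IH: "k \<preceq> S n \<longrightarrow> (\<exists>u. \<forall>i. i \<prec> k \<longrightarrow> (\<exists>g. G i g \<and> beta M u v i g))"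
    show "S k \<preceq> S n \<longrightarrow> (\<exists>u. \<forall>i. i \<prec> S k \<longrightarrow> (\<exists>g. G i g \<and> beta M u v i g))"
    proof
      assume "S k \<preceq> S n"
      then have k: "k \<preceq> n" by simp
      then have "k \<preceq> S n" by (simp add: O.less_imp_le lt_S)
      then obtain u where u: "\<And>i. i \<prec> k \<Longrightarrow> \<exists>g. G i g \<and> beta M u v i g" using IH by blast
      obtain w where w: "\<And>i. i \<prec> k \<Longrightarrow> \<exists>f. w = modulus v i \<otimes> f" "unit (modulus v k) w"
        using coprime_product[OF v(1,3), of n k] k by auto
      obtain s where s: "cong (modulus v k) (w \<otimes> s) \<one>" using w(2) by (auto simp only: unit_def)
      obtain g where g: "G k g" "g \<preceq> B" using bd[OF k] by blast
      \<comment> \<open>The correction is a multiple of \<open>w\<close>, so earlier remainders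
        survive. Modulo the k-th modulus \<open>w \<otimes> s\<close> is 1 and
        \<open>S k \<otimes> v\<close> is -1, so the result is u + (g - u) = g.\<close>
      define u' where "u' = u \<oplus> w \<otimes> s \<otimes> (g \<oplus> u \<otimes> (S k \<otimes> v))"
      have "cong (modulus v k) u' (u \<oplus> (g \<oplus> u \<otimes> (S k \<otimes> v)))"
        unfolding u'_def using cong_add[OF cong_refl cong_mul[OF s]] by simp
      also have "u \<oplus> (g \<oplus> u \<otimes> (S k \<otimes> v)) = g \<oplus> u \<otimes> modulus v k"
        by (simp only: mul_S[of u "S k \<otimes> v"] add_ac)
      also have "cong (modulus v k) \<dots> (g \<oplus> \<zero>)" by (intro cong_add cong_refl cong_multiple)
      finally have "cong (modulus v k) u' g" by simp
      then have new: "beta M u' v k g" using beta_iff_cong lt_modulus g(2) v(2) O.order_trans by blast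
      have "\<exists>g. G i g \<and> beta M u' v i g" if "i \<prec> k" for i
      proof -
        obtain h where h: "G i h" "beta M u v i h" using u \<open>i \<prec> k\<close> by blast
        then have lt: "h \<prec> modulus v i" by (simp add: beta_def)
        obtain f where f: "w = modulus v i \<otimes> f" using w(1) \<open>i \<prec> k\<close> by blast
        have "cong (modulus v i) u' (u \<oplus> \<zero>)" unfolding u'_def f mul_assoc by (intro cong_add cong_refl cong_multiple)
        moreover have "cong (modulus v i) u h" using h(2) beta_iff_cong[OF lt] by blast
        ultimately have "beta M u' v i h" using beta_iff_cong[OF lt] cong_trans by simp
        then show ?thesis using h(1) by blast
      qed
      then have "\<forall>i. i \<prec> S k \<longrightarrow> (\<exists>g. G i g \<and> beta M u' v i g)"
        using new g(1) by (metis lt_S O.le_less)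
      then show "\<exists>u. \<forall>i. i \<prec> S k \<longrightarrow> (\<exists>g. G i g \<and> beta M u v i g)" by blast
    qed
  qed simp
  from this[of "S n"] show ?thesis by (simp add: lt_S) blast
qed

section \<open>Existence and uniqueness of powers of two\<close>

lemma pow2_zero: "pow2 M \<zero> p \<longleftrightarrow> p = \<one>"
proof
  have *: "beta M \<one> \<one> \<zero> \<one>" unfolding beta_def by (auto intro: exI[of _ "\<zero>"])
  assume "p = \<one>"
  then show "pow2 M \<zero> p" unfolding pow2_def using * by auto
qed (use beta_unique in \<open>auto simp: pow2_def\<close>)

lemma pow2_S: "pow2 M (S n) p' \<longleftrightarrow> (\<exists>p. pow2 M n p \<and> p' = p \<oplus> p)"
proof
  assume "pow2 M (S n) p'"
  then obtain u v where uv: "beta M u v \<zero> \<one>" "beta M u v (S n) p'"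
    "\<And>i. i \<prec> S n \<Longrightarrow> \<exists>y. beta M u v i y \<and> beta M u v (S i) (y \<oplus> y)"
    by (auto simp: pow2_def)
  obtain p where p: "beta M u v n p" "beta M u v (S n) (p \<oplus> p)" using uv(3)[of n] by auto
  have "pow2 M n p" unfolding pow2_def using uv(1) p(1) uv(3) by (meson O.less_imp_le lt_S)
  moreover have "p' = p \<oplus> p" using uv(2) p(2) beta_unique by blast
  ultimately show "\<exists>p. pow2 M n p \<and> p' = p \<oplus> p" by blast
next
  assume "\<exists>p. pow2 M n p \<and> p' = p \<oplus> p"
  then obtain p u v where p: "p' = p \<oplus> p" "beta M u v \<zero> \<one>" "beta M u v n p"
    "\<And>i. i \<prec> n \<Longrightarrow> \<exists>y. beta M u v i y \<and> beta M u v (S i) (y \<oplus> y)"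
    by (auto simp: pow2_def)
  \<comment> \<open>The given code determines its values at all indices, so a value at
    \<open>S n\<close> cannot just be appended. The old values up to \<open>n\<close> and the new
    one form a definable relation that is coded afresh.\<close>
  define G where "G i g \<longleftrightarrow> (i \<preceq> n \<and> beta M u v i g) \<or> (i = S n \<and> g = p')" for i g
  have ex: "\<exists>g. beta M u v i g" for i
    unfolding beta_def by (rule div_ex[of "modulus v i" u]) auto
  have G: "dfn M UNIV (\<lambda>e. G (e 0) (e 1))" unfolding G_def by (intro dfn_rules dfn_le)
  have bd: "\<exists>g. G i g \<and> g \<preceq> u \<oplus> p'" if "i \<preceq> S n" for i
  proof (cases "i = S n")
    case False
    then have "i \<preceq> n" using that by (metis O.le_less lt_S)
    then show ?thesis using ex[of i] beta_le[of u v i] O.order_trans[OF _ le_add1] unfolding G_def by blast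
  qed (auto simp: G_def)
  obtain u' v' where uv': "\<And>i. i \<preceq> S n \<Longrightarrow> \<exists>g. G i g \<and> beta M u' v' i g"
    using beta_code[OF G bd] by blast
  have eq: "beta M u' v' i g" if bi: "beta M u v i g" and i: "i \<preceq> n" for i g
  proof -
    have "i \<noteq> S n" using i by (metis O.not_less lt_S_self)
    then obtain h where "beta M u v i h" "beta M u' v' i h"
      using uv'[of i] i unfolding G_def by (metis O.less_imp_le lt_S)
    then show ?thesis using beta_unique[OF bi] by metis
  qed
  have last: "beta M u' v' (S n) p'"
    using uv'[of "S n"] unfolding G_def by (metis O.not_less lt_S_self O.order_refl)
  have "\<exists>y. beta M u' v' i y \<and> beta M u' v' (S i) (y \<oplus> y)" if "i \<prec> S n" for i
  proof (cases "i = n")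
    case True
    then show ?thesis using last eq[OF p(3)] p(1) by auto
  next
    case False
    then have "i \<prec> n" using that by (metis O.le_less lt_S)
    then show ?thesis using p(4)[of i] eq by (metis O.less_imp_le lt_iff_S_le)
  qed
  then show "pow2 M (S n) p'" unfolding pow2_def using last eq[OF p(2)] by auto
qed

lemma pow2_ex1: "\<exists>!p. pow2 M n p"
proof (rule ind[where P = "\<lambda>n. \<exists>!p. pow2 M n p"])
  show "dfn1 (\<lambda>n. \<exists>!p. pow2 M n p)" unfolding Ex1_def by (intro dfn_rules)
qed (auto simp: pow2_zero pow2_S)

definition pw :: "'a \<Rightarrow> 'a" where "pw n = (THE p. pow2 M n p)"

lemma pow2_iff: "pow2 M n p \<longleftrightarrow> p = pw n"
  unfolding pw_def by (auto intro: theI'[OF pow2_ex1] the1_equality[OF pow2_ex1, symmetric])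

lemma pw_zero [simp]: "pw \<zero> = \<one>"
  using pow2_iff[of "\<zero>" "\<one>"] by (simp add: pow2_zero)

lemma pw_S: "pw (S n) = pw n \<oplus> pw n"
  using pow2_S[of n "pw n \<oplus> pw n"] unfolding pow2_iff by auto

end

section \<open>Coded finite sets\<close>

context pa begin

text \<open>\<open>pw\<close> is a function of HOL and no term of the language, so its graph is what
  is definable. This is why inductions about \<open>pw\<close> are stated with an auxiliary
  \<open>\<exists>p. pw n = p\<close>.\<close>

lemma dfn_pw_eq: "dterm M UNIV f \<Longrightarrow> dterm M UNIV g \<Longrightarrow> dfn M UNIV (\<lambda>e. pw (f e) = g e)"
  by (rule dfn_subst2) (unfold eq_commute[of "pw _"] pow2_iff[symmetric], intro dfn_rules)

lemma pw_nonzero [simp]: "pw n \<noteq> \<zero>"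
  by (rule ind[where P = "\<lambda>n. pw n \<noteq> \<zero>"]) (intro dfn.neg dfn_pw_eq dfn_rules, simp_all add: pw_S)

lemma lt_pw: "n \<prec> pw n"
proof -
  have "\<exists>p. pw n = p \<and> n \<prec> p"
  proof (rule ind[where P = "\<lambda>n. \<exists>p. pw n = p \<and> n \<prec> p"])
    show "dfn1 (\<lambda>n. \<exists>p. pw n = p \<and> n \<prec> p)" by (intro dfn_ex dfn_conj dfn_pw_eq dfn_rules)
    fix n assume "\<exists>p. pw n = p \<and> n \<prec> p"
    then have "S n \<preceq> pw n" by (simp add: lt_iff_S_le)
    moreover have "pw n \<oplus> \<zero> \<prec> pw n \<oplus> pw n" unfolding add_lt_cancel by (simp add: zero_lt_iff)
    ultimately show "\<exists>p. pw (S n) = p \<and> S n \<prec> p" by (auto simp: pw_S)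
  qed simp
  then show ?thesis by simp
qed

lemma pw_add: "pw (n \<oplus> k) = pw n \<otimes> pw k"
proof -
  have "\<exists>p. pw k = p \<and> pw (n \<oplus> k) = pw n \<otimes> p"
  proof (rule ind[where P = "\<lambda>k. \<exists>p. pw k = p \<and> pw (n \<oplus> k) = pw n \<otimes> p"])
    show "dfn1 (\<lambda>k. \<exists>p. pw k = p \<and> pw (n \<oplus> k) = pw n \<otimes> p)"
      by (intro dfn_ex dfn_conj dfn_pw_eq dfn_rules)
  qed (auto simp: pw_S add_S distrib_left)
  then show ?thesis by simp
qed

section \<open>Parity and binary digits\<close>

lemma parity: "\<exists>q. x = q \<oplus> q \<or> x = S (q \<oplus> q)"
proof (rule ind[where P = "\<lambda>x. \<exists>q. x = q \<oplus> q \<or> x = S (q \<oplus> q)"])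
  show "dfn1 (\<lambda>x. \<exists>q. x = q \<oplus> q \<or> x = S (q \<oplus> q))" by (intro dfn_rules)
  fix x assume "\<exists>q. x = q \<oplus> q \<or> x = S (q \<oplus> q)"
  then obtain q where "x = q \<oplus> q \<or> x = S (q \<oplus> q)" ..
  then have "S x = S (q \<oplus> q) \<or> S x = S q \<oplus> S q" by (auto simp: S_add add_S)
  then show "\<exists>q. S x = q \<oplus> q \<or> S x = S (q \<oplus> q)" by blast
qed (auto intro: exI[of _ "\<zero>"])

lemma two_mul: "x \<otimes> S \<one> = x \<oplus> x"
  by (simp add: mul_S)

lemma double_inj [simp]: "x \<oplus> x = y \<oplus> y \<longleftrightarrow> x = y"
  by (metis two_mul mul_right_cancel S_not_zero(1))

lemma even_neq_odd [simp]: "x \<oplus> x \<noteq> S (y \<oplus> y)" "S (y \<oplus> y) \<noteq> x \<oplus> x"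
proof -
  show "x \<oplus> x \<noteq> S (y \<oplus> y)"
  proof
    assume "x \<oplus> x = S (y \<oplus> y)"
    then have "x \<otimes> S \<one> \<oplus> \<zero> = y \<otimes> S \<one> \<oplus> \<one>" by (simp add: two_mul add_S)
    then show False using div_unique[of "\<zero>" "S \<one>" "\<one>" x y] by simp
  qed
  then show "S (y \<oplus> y) \<noteq> x \<oplus> x" by metis
qed

definition odd_M :: "'a \<Rightarrow> bool" where "odd_M x \<longleftrightarrow> (\<exists>q. x = S (q \<oplus> q))"

lemma odd_M_simps [simp]: "\<not> odd_M (x \<oplus> x)" "odd_M (S (x \<oplus> x))"
  by (auto simp: odd_M_def)

lemma odd_M_S: "odd_M (S x) \<longleftrightarrow> \<not> odd_M x"
  using parity[of x] odd_M_simps(1)[of "S q" for q] by (auto simp: S_add add_S)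

lemma odd_M_add_even [simp]: "odd_M (x \<oplus> (t \<oplus> t)) \<longleftrightarrow> odd_M x"
proof -
  obtain q where "x = q \<oplus> q \<or> x = S (q \<oplus> q)" using parity by blast
  moreover have "q \<oplus> q \<oplus> (t \<oplus> t) = (q \<oplus> t) \<oplus> (q \<oplus> t)" by (simp only: add_ac)
  ultimately show ?thesis by (auto simp: S_add)
qed

lemma mem_iff: "mem M n c \<longleftrightarrow> (\<exists>q r. r \<prec> pw n \<and> c = S (q \<oplus> q) \<otimes> pw n \<oplus> r)"
  unfolding mem_def pow2_iff by auto

lemma mem_div:
  assumes "r \<prec> pw n"
  shows "mem M n (Q \<otimes> pw n \<oplus> r) \<longleftrightarrow> odd_M Q"
  unfolding mem_iff odd_M_def using assms div_unique by metis

lemma mem_le: "mem M n c \<Longrightarrow> pw n \<preceq> c"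
  unfolding mem_iff by (auto simp: S_mul add_assoc) (metis le_add1 add_left_comm)

lemma mem_lt: "mem M n c \<Longrightarrow> n \<prec> c"
  using mem_le lt_pw O.less_le_trans by blast

lemma not_mem_zero [simp]: "\<not> mem M n \<zero>"
  using mem_le[of n "\<zero>"] by auto

text \<open>Adding 2^n where that digit is zero causes no carry. Below n the quotient changes by an
  even number, at n its parity flips, and above n it must be shown not to change.\<close>

lemma mem_add_pw:
  assumes "\<not> mem M n c"
  shows "mem M z (c \<oplus> pw n) \<longleftrightarrow> mem M z c \<or> z = n"
proof -
  consider "z = n" | "z \<prec> n" | "n \<prec> z" using O.less_linear by blast
  then show ?thesis
  proof cases
    case 1
    obtain q r where c: "r \<prec> pw n" "c = q \<otimes> pw n \<oplus> r" by (rule div_ex[OF pw_nonzero])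
    have "c \<oplus> pw n = S q \<otimes> pw n \<oplus> r" unfolding c(2) by (simp only: S_mul add_ac)
    then show ?thesis using assms c mem_div odd_M_S 1 by simp
  next
    case 2
    obtain k where "n = z \<oplus> S k" using 2 by (auto simp: lt_def)
    then have pw: "pw n = (pw k \<oplus> pw k) \<otimes> pw z" by (simp only: pw_add pw_S mul_comm)
    obtain q r where c: "r \<prec> pw z" "c = q \<otimes> pw z \<oplus> r" by (rule div_ex[OF pw_nonzero])
    have "c \<oplus> pw n = (q \<oplus> (pw k \<oplus> pw k)) \<otimes> pw z \<oplus> r"
      unfolding c(2) pw distrib_right by (simp only: add_ac)
    then show ?thesis using c mem_div 2 by auto
  next
    case 3
    then obtain k where "z = n \<oplus> S k" by (auto simp: lt_def)
    then have pw: "pw z = (pw k \<oplus> pw k) \<otimes> pw n" by (simp only: pw_add pw_S mul_comm)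
    obtain q r where c: "r \<prec> pw z" "c = q \<otimes> pw z \<oplus> r" by (rule div_ex[OF pw_nonzero])
    obtain q' r' where r: "r' \<prec> pw n" "r = q' \<otimes> pw n \<oplus> r'" by (rule div_ex[OF pw_nonzero])
    have "c = (q' \<oplus> (q \<otimes> pw k \<oplus> q \<otimes> pw k)) \<otimes> pw n \<oplus> r'"
      unfolding c(2) r(2) pw by (simp only: distrib_left distrib_right add_ac mul_assoc)
    then have "\<not> odd_M q'" using assms mem_div[OF r(1)] by simp
    \<comment> \<open>The n-th digit is zero, so \<open>q'\<close> is even. Being below the even
      number \<open>pw k \<oplus> pw k\<close>, it leaves room for two more, and so the remainder
      stays below \<open>pw z\<close> after \<open>pw n\<close> is added.\<close>
    then obtain a where a: "q' = a \<oplus> a" using parity odd_M_def by metis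
    have "(a \<oplus> a) \<otimes> pw n \<preceq> r" unfolding r(2) a by simp
    then have "(a \<oplus> a) \<otimes> pw n \<prec> (pw k \<oplus> pw k) \<otimes> pw n" using c(1) unfolding pw by (rule O.le_less_trans)
    then have "a \<oplus> a \<prec> pw k \<oplus> pw k" by (simp add: mul_lt_cancel)
    then have "a \<prec> pw k" by (meson O.not_less add_le_mono)
    then have "S a \<oplus> S a \<preceq> pw k \<oplus> pw k" by (intro add_le_mono) (simp_all add: lt_iff_S_le)
    then have "S (S q') \<otimes> pw n \<preceq> pw z" unfolding pw a by (intro mul_le_mono) (simp add: S_add add_S)
    moreover have "r \<oplus> pw n \<prec> S (S q') \<otimes> pw n"
    proof -
      have "r \<oplus> pw n = (q' \<otimes> pw n \<oplus> pw n) \<oplus> r'" unfolding r(2) by (simp only: add_ac)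
      also have "\<dots> \<prec> (q' \<otimes> pw n \<oplus> pw n) \<oplus> pw n" using r(1) by simp
      finally show ?thesis by (simp only: S_mul)
    qed
    ultimately have "r \<oplus> pw n \<prec> pw z" by (metis O.less_le_trans)
    moreover have "c \<oplus> pw n = q \<otimes> pw z \<oplus> (r \<oplus> pw n)" unfolding c(2) by (simp only: add_ac)
    ultimately show ?thesis using c mem_div 3 by auto
  qed
qed

definition ins :: "'a \<Rightarrow> 'a \<Rightarrow> 'a" where
  "ins n c = (if mem M n c then c else c \<oplus> pw n)"

lemma mem_ins [simp]: "mem M z (ins n c) \<longleftrightarrow> z = n \<or> mem M z c"
  unfolding ins_def using mem_add_pw by auto

lemma mem_zero_iff: "mem M \<zero> c \<longleftrightarrow> odd_M c"
  using mem_div[of "\<zero>" "\<zero>" c] by simp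

text \<open>Halving shifts the digits by one place. This drives the proofs of \<open>mem_ex\<close>
  and \<open>set_ext\<close>, and later lets a stage hand the remaining digits to the next
  one.\<close>

lemma mem_S_double [simp]: "mem M (S n) (q \<oplus> q) \<longleftrightarrow> mem M n q" "mem M (S n) (S (q \<oplus> q)) \<longleftrightarrow> mem M n q"
proof -
  obtain Q r where q: "r \<prec> pw n" "q = Q \<otimes> pw n \<oplus> r" by (rule div_ex[OF pw_nonzero])
  have "S r \<oplus> S r \<preceq> pw n \<oplus> pw n" using q(1) by (intro add_le_mono) (simp_all add: lt_iff_S_le)
  then have r: "S (r \<oplus> r) \<prec> pw (S n)" by (simp add: S_add add_S lt_iff_S_le pw_S)
  then have r': "r \<oplus> r \<prec> pw (S n)" using lt_S_self O.less_trans by blast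
  have "q \<oplus> q = Q \<otimes> pw (S n) \<oplus> (r \<oplus> r)" unfolding q(2) pw_S distrib_left by (simp only: add_ac)
  moreover from this have "S (q \<oplus> q) = Q \<otimes> pw (S n) \<oplus> S (r \<oplus> r)" by (simp only: add_S)
  ultimately show "mem M (S n) (q \<oplus> q) \<longleftrightarrow> mem M n q" "mem M (S n) (S (q \<oplus> q)) \<longleftrightarrow> mem M n q"
    using mem_div[OF r] mem_div[OF r'] mem_div[OF q(1)] q(2) by simp_all
qed

lemma half_lt: "x = q \<oplus> q \<or> x = S (q \<oplus> q) \<Longrightarrow> x \<noteq> \<zero> \<Longrightarrow> q \<prec> x"
  by (auto simp: lt_S zero_lt_iff[symmetric]) (metis add_lt_cancel(2) add_zero zero_lt_iff)

lemma mem_ex: "c \<noteq> \<zero> \<longrightarrow> (\<exists>z. mem M z c)"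
proof (rule less_ind[where P = "\<lambda>c. c \<noteq> \<zero> \<longrightarrow> (\<exists>z. mem M z c)"])
  show "dfn1 (\<lambda>c. c \<noteq> \<zero> \<longrightarrow> (\<exists>z. mem M z c))" by (intro dfn_rules)
  fix c assume IH: "\<And>y. y \<prec> c \<Longrightarrow> y \<noteq> \<zero> \<longrightarrow> (\<exists>z. mem M z y)"
  show "c \<noteq> \<zero> \<longrightarrow> (\<exists>z. mem M z c)"
  proof
    assume "c \<noteq> \<zero>"
    obtain q where q: "c = q \<oplus> q \<or> c = S (q \<oplus> q)" using parity by blast
    then have "q \<prec> c" using \<open>c \<noteq> \<zero>\<close> half_lt by blast
    show "\<exists>z. mem M z c"
    proof (cases "odd_M c")
      case True
      then show ?thesis using mem_zero_iff by blast
    next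
      case False
      then have "c = q \<oplus> q" using q by auto
      then have "\<exists>z. mem M z q" using IH[OF \<open>q \<prec> c\<close>] \<open>c \<noteq> \<zero>\<close> by auto
      then show ?thesis using \<open>c = q \<oplus> q\<close> mem_S_double(1) by blast
    qed
  qed
qed

text \<open>Course-of-values induction: equal sets have the same last digit, and their halves are
  equal sets again. Extensionality turns sets given by a property, and restrictions of assignments,
  into unique objects.\<close>

lemma set_ext: "(\<And>z. mem M z c \<longleftrightarrow> mem M z d) \<Longrightarrow> c = d"
proof -
  have "\<forall>d. (\<forall>z. mem M z c \<longleftrightarrow> mem M z d) \<longrightarrow> c = d"
  proof (rule less_ind[where P = "\<lambda>c. \<forall>d. (\<forall>z. mem M z c \<longleftrightarrow> mem M z d) \<longrightarrow> c = d"])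
    show "dfn1 (\<lambda>c. \<forall>d. (\<forall>z. mem M z c \<longleftrightarrow> mem M z d) \<longrightarrow> c = d)" by (intro dfn_rules)
    fix c assume IH: "\<And>y. y \<prec> c \<Longrightarrow> \<forall>d. (\<forall>z. mem M z y \<longleftrightarrow> mem M z d) \<longrightarrow> y = d"
    show "\<forall>d. (\<forall>z. mem M z c \<longleftrightarrow> mem M z d) \<longrightarrow> c = d"
    proof (intro allI impI)
      fix d assume eq: "\<forall>z. mem M z c \<longleftrightarrow> mem M z d"
      show "c = d"
      proof (cases "c = \<zero>")
        case True
        then show ?thesis using eq mem_ex[of d] by auto
      next
        case False
        obtain q where q: "c = q \<oplus> q \<or> c = S (q \<oplus> q)" using parity by blast
        obtain p where p: "d = p \<oplus> p \<or> d = S (p \<oplus> p)" using parity by blast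
        have "mem M z q \<longleftrightarrow> mem M z p" for z using eq[rule_format, of "S z"] p q by auto
        then have "q = p" using IH half_lt[OF q False] by blast
        moreover have "odd_M c \<longleftrightarrow> odd_M d" using eq mem_zero_iff by blast
        ultimately show ?thesis using p q by auto
      qed
    qed
  qed
  then show "(\<And>z. mem M z c \<longleftrightarrow> mem M z d) \<Longrightarrow> c = d" by blast
qed

lemma comprehension:
  assumes P: "dfn1 P" and "\<And>z. P z \<Longrightarrow> z \<prec> b"
  shows "\<exists>c. \<forall>z. mem M z c \<longleftrightarrow> P z"
proof -
  have "\<exists>c. \<forall>z. mem M z c \<longleftrightarrow> z \<prec> b \<and> P z"
  proof (rule ind[where P = "\<lambda>b. \<exists>c. \<forall>z. mem M z c \<longleftrightarrow> z \<prec> b \<and> P z"])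
    show "dfn1 (\<lambda>b. \<exists>c. \<forall>z. mem M z c \<longleftrightarrow> z \<prec> b \<and> P z)" by (intro dfn_rules dfn_subst1[OF P])
    show "\<exists>c. \<forall>z. mem M z c \<longleftrightarrow> z \<prec> \<zero> \<and> P z" by (auto intro: exI[of _ "\<zero>"])
    fix b assume "\<exists>c. \<forall>z. mem M z c \<longleftrightarrow> z \<prec> b \<and> P z"
    then obtain c where c: "\<forall>z. mem M z c \<longleftrightarrow> z \<prec> b \<and> P z" ..
    have "mem M z (if P b then ins b c else c) \<longleftrightarrow> z \<prec> S b \<and> P z" for z
      using c by (auto simp: lt_S O.le_less)
    then show "\<exists>c. \<forall>z. mem M z c \<longleftrightarrow> z \<prec> S b \<and> P z" by blast
  qed
  then show ?thesis using assms(2) by metis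
qed

definition coll :: "('a \<Rightarrow> bool) \<Rightarrow> 'a" where
  "coll P = (THE c. \<forall>z. mem M z c \<longleftrightarrow> P z)"

lemma mem_coll:
  assumes "dfn1 P" "\<And>z. P z \<Longrightarrow> z \<prec> b"
  shows "mem M z (coll P) \<longleftrightarrow> P z"
proof -
  obtain c where c: "\<forall>z. mem M z c \<longleftrightarrow> P z" using comprehension[OF assms] by blast
  then have "coll P = c" unfolding coll_def by (intro the_equality) (auto intro: set_ext)
  then show ?thesis using c by simp
qed

definition un :: "'a \<Rightarrow> 'a \<Rightarrow> 'a" where
  "un c d = coll (\<lambda>z. mem M z c \<or> mem M z d)"

lemma mem_un [simp]: "mem M z (un c d) \<longleftrightarrow> mem M z c \<or> mem M z d"
  unfolding un_def
proof (rule mem_coll)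
  show "dfn1 (\<lambda>z. mem M z c \<or> mem M z d)" by (intro dfn_rules)
  show "mem M z c \<or> mem M z d \<Longrightarrow> z \<prec> c \<oplus> d" for z
    using mem_lt O.less_le_trans le_add1 le_add2 by blast
qed

definition sep :: "'a \<Rightarrow> ('a \<Rightarrow> bool) \<Rightarrow> 'a" where
  "sep c P = coll (\<lambda>z. mem M z c \<and> P z)"

lemma mem_sep: "dfn1 P \<Longrightarrow> mem M z (sep c P) \<longleftrightarrow> mem M z c \<and> P z"
  unfolding sep_def
proof (rule mem_coll)
  show "dfn1 P \<Longrightarrow> dfn1 (\<lambda>z. mem M z c \<and> P z)" by (intro dfn_rules)
qed (use mem_lt in blast)

section \<open>Pairs and numerals\<close>

lemma pair_less: "x \<oplus> y \<prec> x' \<oplus> y' \<Longrightarrow> pair M x y \<prec> pair M x' y'"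
proof -
  let ?s = "x \<oplus> y" and ?t = "x' \<oplus> y'"
  assume "?s \<prec> ?t"
  then have "S ?s \<preceq> ?t" by (simp add: lt_iff_S_le)
  have "pair M x y \<preceq> ?s \<otimes> ?s \<oplus> ?s" unfolding pair_def by simp
  also have "\<dots> = S ?s \<otimes> ?s" by (simp only: S_mul)
  also have "\<dots> \<prec> S ?s \<otimes> S ?s" unfolding mul_comm[of "S ?s" ?s] by (rule mul_lt_mono) simp_all
  also have "\<dots> \<preceq> ?t \<otimes> S ?s" using \<open>S ?s \<preceq> ?t\<close> by (rule mul_le_mono)
  also have "\<dots> \<preceq> ?t \<otimes> ?t" unfolding mul_comm[of ?t "S ?s"] using \<open>S ?s \<preceq> ?t\<close> by (rule mul_le_mono)
  also have "\<dots> \<preceq> pair M x' y'" unfolding pair_def by simp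
  finally show ?thesis .
qed

lemma pair_inj [simp]: "pair M x y = pair M x' y' \<longleftrightarrow> x = x' \<and> y = y'"
proof
  assume eq: "pair M x y = pair M x' y'"
  then have "x \<oplus> y = x' \<oplus> y'" using pair_less O.neqE O.less_irrefl by metis
  moreover from this have "x = x'" using eq unfolding pair_def by simp
  ultimately show "x = x' \<and> y = y'" by simp
qed simp

lemma num_simps: "num M 0 = \<zero>" "num M (Suc n) = S (num M n)"
  by (simp_all add: num_def)

lemma num_inj [simp]: "num M m = num M n \<longleftrightarrow> m = n"
proof (induction m arbitrary: n)
  case 0
  show ?case by (cases n) (simp_all add: num_simps)
next
  case (Suc m)
  then show ?case by (cases n) (simp_all add: num_simps)
qed

end

section \<open>Coded syntax\<close>

context pa begin

text \<open>The common scheme of the recursive notions: \<open>\<Phi> P x\<close> reads as x being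
  obtainable in one step from objects satisfying \<open>P\<close>.\<close>

definition formed :: "(('a \<Rightarrow> bool) \<Rightarrow> 'a \<Rightarrow> bool) \<Rightarrow> 'a \<Rightarrow> bool" where
  "formed \<Phi> x \<longleftrightarrow> (\<exists>c. mem M x c \<and> (\<forall>y. mem M y c \<longrightarrow> \<Phi> (\<lambda>s. mem M s c) y))"

text \<open>Backwards, the witnessing sets of the predecessors are united and \<open>x\<close> is
  inserted. Assumption \<open>fin\<close> says that at most two predecessors matter, so the union is
  again a coded set.\<close>

lemma formed_iff:
  assumes mono: "\<And>P Q x. \<Phi> P x \<Longrightarrow> (\<And>s. P s \<Longrightarrow> Q s) \<Longrightarrow> \<Phi> Q x"
    and fin: "\<And>P x. \<Phi> P x \<Longrightarrow> \<Phi> (\<lambda>_. False) x \<or> (\<exists>a b. P a \<and> P b \<and> \<Phi> (\<lambda>s. s = a \<or> s = b) x)"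
  shows "formed \<Phi> x \<longleftrightarrow> \<Phi> (formed \<Phi>) x"
proof
  assume "formed \<Phi> x"
  then obtain c where c: "mem M x c" "\<And>y. mem M y c \<Longrightarrow> \<Phi> (\<lambda>s. mem M s c) y" by (auto simp: formed_def)
  show "\<Phi> (formed \<Phi>) x"
    by (rule mono[OF c(2)[OF c(1)]]) (use c(2) in \<open>auto simp: formed_def\<close>)
next
  assume "\<Phi> (formed \<Phi>) x"
  from fin[OF this] show "formed \<Phi> x"
  proof (elim disjE exE conjE)
    assume 0: "\<Phi> (\<lambda>_. False) x"
    show ?thesis unfolding formed_def
      by (rule exI[of _ "ins x \<zero>"]) (auto intro: mono[OF 0])
  next
    fix a b assume "formed \<Phi> a" "formed \<Phi> b" and x: "\<Phi> (\<lambda>s. s = a \<or> s = b) x"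
    then obtain c d where c: "mem M a c" "\<And>y. mem M y c \<Longrightarrow> \<Phi> (\<lambda>s. mem M s c) y"
      and d: "mem M b d" "\<And>y. mem M y d \<Longrightarrow> \<Phi> (\<lambda>s. mem M s d) y" unfolding formed_def by blast
    have "\<Phi> (\<lambda>s. mem M s (ins x (un c d))) y" if "mem M y (ins x (un c d))" for y
    proof -
      consider "y = x" | "mem M y c" | "mem M y d" using \<open>mem M y _\<close> by auto
      then show ?thesis
      proof cases
        case 1
        show ?thesis unfolding 1 by (rule mono[OF x]) (use c d in auto)
      next
        case 2
        show ?thesis by (rule mono[OF c(2)[OF 2]]) simp
      next
        case 3
        show ?thesis by (rule mono[OF d(2)[OF 3]]) simp
      qed
    qed
    then show ?thesis unfolding formed_def by (intro exI[of _ "ins x (un c d)"]) simp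
  qed
qed

lemma is_term_iff: "is_term M y \<longleftrightarrow>
     (\<exists>i. y = cVar M i) \<or>
     y = cZero M \<or>
     (\<exists>s. y = cSucc M s \<and> is_term M s) \<or>
     (\<exists>s t. y = cPlus M s t \<and> is_term M s \<and> is_term M t) \<or>
     (\<exists>s t. y = cTimes M s t \<and> is_term M s \<and> is_term M t)"
proof -
  define \<Phi> where "\<Phi> P y \<longleftrightarrow>
     (\<exists>i. y = cVar M i) \<or>
     y = cZero M \<or>
     (\<exists>s. y = cSucc M s \<and> P s) \<or>
     (\<exists>s t. y = cPlus M s t \<and> P s \<and> P t) \<or>
     (\<exists>s t. y = cTimes M s t \<and> P s \<and> P t)" for P y
  have *: "is_term M = formed \<Phi>" by (simp add: fun_eq_iff is_term_def formed_def \<Phi>_def)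
  have "formed \<Phi> y \<longleftrightarrow> \<Phi> (formed \<Phi>) y"
  proof (rule formed_iff)
    show "\<Phi> P x \<Longrightarrow> (\<And>s. P s \<Longrightarrow> Q s) \<Longrightarrow> \<Phi> Q x" for P Q x unfolding \<Phi>_def by blast
    show "\<Phi> P x \<Longrightarrow> \<Phi> (\<lambda>_. False) x \<or> (\<exists>a b. P a \<and> P b \<and> \<Phi> (\<lambda>s. s = a \<or> s = b) x)" for P x
      unfolding \<Phi>_def by blast
  qed
  then show ?thesis unfolding * \<Phi>_def .
qed

lemma is_form_iff: "is_form M y \<longleftrightarrow>
     (\<exists>s t. y = cEq M s t \<and> is_term M s \<and> is_term M t) \<or>
     (\<exists>\<phi> \<psi>. y = cOr M \<phi> \<psi> \<and> is_form M \<phi> \<and> is_form M \<psi>) \<or>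
     (\<exists>\<phi>. y = cNeg M \<phi> \<and> is_form M \<phi>) \<or>
     (\<exists>v \<phi>. y = cEx M v \<phi> \<and> is_form M \<phi>)"
proof -
  define \<Phi> where "\<Phi> P y \<longleftrightarrow>
     (\<exists>s t. y = cEq M s t \<and> is_term M s \<and> is_term M t) \<or>
     (\<exists>\<phi> \<psi>. y = cOr M \<phi> \<psi> \<and> P \<phi> \<and> P \<psi>) \<or>
     (\<exists>\<phi>. y = cNeg M \<phi> \<and> P \<phi>) \<or>
     (\<exists>v \<phi>. y = cEx M v \<phi> \<and> P \<phi>)" for P y
  have *: "is_form M = formed \<Phi>" by (simp add: fun_eq_iff is_form_def formed_def \<Phi>_def)
  have "formed \<Phi> y \<longleftrightarrow> \<Phi> (formed \<Phi>) y"
  proof (rule formed_iff)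
    show "\<Phi> P x \<Longrightarrow> (\<And>s. P s \<Longrightarrow> Q s) \<Longrightarrow> \<Phi> Q x" for P Q x unfolding \<Phi>_def by blast
    show "\<Phi> P x \<Longrightarrow> \<Phi> (\<lambda>_. False) x \<or> (\<exists>a b. P a \<and> P b \<and> \<Phi> (\<lambda>s. s = a \<or> s = b) x)" for P x
      unfolding \<Phi>_def by blast
  qed
  then show ?thesis unfolding * \<Phi>_def .
qed

lemma occurs_iff: "occurs M v y \<longleftrightarrow>
     y = cVar M v \<or>
     (\<exists>s. y = cSucc M s \<and> occurs M v s) \<or>
     (\<exists>s t. y = cPlus M s t \<and> (occurs M v s \<or> occurs M v t)) \<or>
     (\<exists>s t. y = cTimes M s t \<and> (occurs M v s \<or> occurs M v t))"
proof -
  define \<Phi> where "\<Phi> P y \<longleftrightarrow>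
     y = cVar M v \<or>
     (\<exists>s. y = cSucc M s \<and> P s) \<or>
     (\<exists>s t. y = cPlus M s t \<and> (P s \<or> P t)) \<or>
     (\<exists>s t. y = cTimes M s t \<and> (P s \<or> P t))" for P y
  have *: "occurs M v = formed \<Phi>" by (simp add: fun_eq_iff occurs_def formed_def \<Phi>_def)
  have "formed \<Phi> y \<longleftrightarrow> \<Phi> (formed \<Phi>) y"
  proof (rule formed_iff)
    show "\<Phi> P x \<Longrightarrow> (\<And>s. P s \<Longrightarrow> Q s) \<Longrightarrow> \<Phi> Q x" for P Q x unfolding \<Phi>_def by blast
    show "\<Phi> P x \<Longrightarrow> \<Phi> (\<lambda>_. False) x \<or> (\<exists>a b. P a \<and> P b \<and> \<Phi> (\<lambda>s. s = a \<or> s = b) x)" for P x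
      unfolding \<Phi>_def by blast
  qed
  then show ?thesis unfolding * \<Phi>_def .
qed

lemma free_in_iff: "free_in M v y \<longleftrightarrow>
     (\<exists>s t. y = cEq M s t \<and> (occurs M v s \<or> occurs M v t)) \<or>
     (\<exists>\<phi> \<psi>. y = cOr M \<phi> \<psi> \<and> (free_in M v \<phi> \<or> free_in M v \<psi>)) \<or>
     (\<exists>\<phi>. y = cNeg M \<phi> \<and> free_in M v \<phi>) \<or>
     (\<exists>u \<phi>. y = cEx M u \<phi> \<and> u \<noteq> v \<and> free_in M v \<phi>)"
proof -
  define \<Phi> where "\<Phi> P y \<longleftrightarrow>
     (\<exists>s t. y = cEq M s t \<and> (occurs M v s \<or> occurs M v t)) \<or>
     (\<exists>\<phi> \<psi>. y = cOr M \<phi> \<psi> \<and> (P \<phi> \<or> P \<psi>)) \<or>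
     (\<exists>\<phi>. y = cNeg M \<phi> \<and> P \<phi>) \<or>
     (\<exists>u \<phi>. y = cEx M u \<phi> \<and> u \<noteq> v \<and> P \<phi>)" for P y
  have *: "free_in M v = formed \<Phi>" by (simp add: fun_eq_iff free_in_def formed_def \<Phi>_def)
  have "formed \<Phi> y \<longleftrightarrow> \<Phi> (formed \<Phi>) y"
  proof (rule formed_iff)
    show "\<Phi> P x \<Longrightarrow> (\<And>s. P s \<Longrightarrow> Q s) \<Longrightarrow> \<Phi> Q x" for P Q x unfolding \<Phi>_def by blast
    show "\<Phi> P x \<Longrightarrow> \<Phi> (\<lambda>_. False) x \<or> (\<exists>a b. P a \<and> P b \<and> \<Phi> (\<lambda>s. s = a \<or> s = b) x)" for P x
      unfolding \<Phi>_def by blast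
  qed
  then show ?thesis unfolding * \<Phi>_def .
qed

lemma is_term_simps [simp]:
  "is_term M (cVar M i)"
  "is_term M (cSucc M s) \<longleftrightarrow> is_term M s"
  "is_term M (cPlus M s t) \<longleftrightarrow> is_term M s \<and> is_term M t"
  by (subst is_term_iff; simp add: code_defs)+

lemma is_form_simps [simp]:
  "is_form M (cEq M s t) \<longleftrightarrow> is_term M s \<and> is_term M t"
  "is_form M (cOr M \<phi> \<psi>) \<longleftrightarrow> is_form M \<phi> \<and> is_form M \<psi>"
  "is_form M (cNeg M \<phi>) \<longleftrightarrow> is_form M \<phi>"
  "is_form M (cEx M v \<phi>) \<longleftrightarrow> is_form M \<phi>"
  by (subst is_form_iff; simp add: code_defs)+

lemma occurs_simps [simp]:
  "occurs M v (cVar M i) \<longleftrightarrow> i = v"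
  "occurs M v (cSucc M s) \<longleftrightarrow> occurs M v s"
  "occurs M v (cPlus M s t) \<longleftrightarrow> occurs M v s \<or> occurs M v t"
  by (subst occurs_iff; simp add: code_defs)+

lemma free_in_simps [simp]:
  "free_in M v (cEq M s t) \<longleftrightarrow> occurs M v s \<or> occurs M v t"
  "free_in M v (cOr M \<phi> \<psi>) \<longleftrightarrow> free_in M v \<phi> \<or> free_in M v \<psi>"
  "free_in M v (cNeg M \<phi>) \<longleftrightarrow> free_in M v \<phi>"
  "free_in M v (cEx M u \<phi>) \<longleftrightarrow> u \<noteq> v \<and> free_in M v \<phi>"
  by (subst free_in_iff; simp add: code_defs)+

lemma is_fun_zero [simp]: "is_fun M \<zero>"
  by (simp add: is_fun_def)

section \<open>Values of the terms v, 2v and 2v + 1\<close>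

definition val_table :: "'a \<Rightarrow> 'a \<Rightarrow> bool" where
  "val_table \<alpha> f \<longleftrightarrow> is_fun M f \<and> (\<forall>t y. mem M (pair M t y) f \<longrightarrow>
       (\<exists>i. t = cVar M i \<and> mem M (pair M i y) \<alpha>) \<or>
       (t = cZero M \<and> y = \<zero>) \<or>
       (\<exists>t1 y1. t = cSucc M t1 \<and> mem M (pair M t1 y1) f \<and> y = S y1) \<or>
       (\<exists>t1 t2 y1 y2. t = cPlus M t1 t2 \<and> mem M (pair M t1 y1) f \<and> mem M (pair M t2 y2) f \<and>
          y = y1 \<oplus> y2) \<or>
       (\<exists>t1 t2 y1 y2. t = cTimes M t1 t2 \<and> mem M (pair M t1 y1) f \<and> mem M (pair M t2 y2) f \<and>
          y = y1 \<otimes> y2))"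

lemma term_val_iff: "term_val M \<alpha> s x \<longleftrightarrow> (\<exists>f. val_table \<alpha> f \<and> mem M (pair M s x) f)"
  unfolding term_val_def val_table_def by blast

lemma val_table_cVar: "val_table \<alpha> f \<Longrightarrow> mem M (pair M (cVar M i) y) f \<Longrightarrow> mem M (pair M i y) \<alpha>"
  unfolding val_table_def by (elim conjE allE[of _ "cVar M i"] allE[of _ y]) (simp add: code_defs)

lemma val_table_cSucc:
  "val_table \<alpha> f \<Longrightarrow> mem M (pair M (cSucc M s) y) f \<Longrightarrow> \<exists>x. mem M (pair M s x) f \<and> y = S x"
  unfolding val_table_def by (elim conjE allE[of _ "cSucc M s"] allE[of _ y]) (simp add: code_defs)

lemma val_table_cPlus:
  "val_table \<alpha> f \<Longrightarrow> mem M (pair M (cPlus M s t) z) f \<Longrightarrow>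
    \<exists>x y. mem M (pair M s x) f \<and> mem M (pair M t y) f \<and> z = x \<oplus> y"
  unfolding val_table_def by (elim conjE allE[of _ "cPlus M s t"] allE[of _ z]) (simp add: code_defs)

lemma val_table_double:
  assumes "val_table \<alpha> f" "mem M (pair M (cPlus M (cVar M w) (cVar M w)) x) f"
  shows "\<exists>y. mem M (pair M w y) \<alpha> \<and> x = y \<oplus> y"
proof -
  obtain y z where y: "mem M (pair M (cVar M w) y) f" "mem M (pair M (cVar M w) z) f" "x = y \<oplus> z"
    using val_table_cPlus[OF assms] by blast
  then have "y = z" using assms(1) unfolding val_table_def is_fun_def by blast
  then show ?thesis using y val_table_cVar[OF assms(1)] by blast
qed

lemma term_val_cVar: "term_val M \<alpha> (cVar M i) x \<longleftrightarrow> mem M (pair M i x) \<alpha>"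
proof
  assume "mem M (pair M i x) \<alpha>"
  then have "val_table \<alpha> (ins (pair M (cVar M i) x) \<zero>)"
    unfolding val_table_def by (auto simp: is_fun_def)
  then show "term_val M \<alpha> (cVar M i) x" unfolding term_val_iff by force
qed (auto simp: term_val_iff val_table_cVar)

lemma term_val_double:
  "term_val M \<alpha> (cPlus M (cVar M w) (cVar M w)) x \<longleftrightarrow> (\<exists>y. mem M (pair M w y) \<alpha> \<and> x = y \<oplus> y)"
proof
  let ?d = "cPlus M (cVar M w) (cVar M w)"
  assume "\<exists>y. mem M (pair M w y) \<alpha> \<and> x = y \<oplus> y"
  then obtain y where "mem M (pair M w y) \<alpha>" "x = y \<oplus> y" by blast
  then have "val_table \<alpha> (ins (pair M ?d x) (ins (pair M (cVar M w) y) \<zero>))"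
    unfolding val_table_def by (auto simp: is_fun_def code_defs)
  then show "term_val M \<alpha> ?d x" unfolding term_val_iff by force
qed (auto simp: term_val_iff val_table_double)

lemma term_val_S_double:
  "term_val M \<alpha> (cSucc M (cPlus M (cVar M w) (cVar M w))) x \<longleftrightarrow>
    (\<exists>y. mem M (pair M w y) \<alpha> \<and> x = S (y \<oplus> y))"
proof
  let ?d = "cPlus M (cVar M w) (cVar M w)"
  assume "\<exists>y. mem M (pair M w y) \<alpha> \<and> x = S (y \<oplus> y)"
  then obtain y where "mem M (pair M w y) \<alpha>" "x = S (y \<oplus> y)" by blast
  then have "val_table \<alpha> (ins (pair M (cSucc M ?d) x) (ins (pair M ?d (y \<oplus> y))
      (ins (pair M (cVar M w) y) \<zero>)))"
    unfolding val_table_def by (auto simp: is_fun_def code_defs)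
  then show "term_val M \<alpha> (cSucc M ?d) x" unfolding term_val_iff by force
qed (use val_table_cSucc val_table_double in \<open>unfold term_val_iff, blast\<close>)

end

section \<open>Evaluation of formulas\<close>

context pa begin

definition upd :: "'a \<Rightarrow> 'a \<Rightarrow> 'a \<Rightarrow> 'a" where
  "upd \<alpha> v x = ins (pair M v x) (sep \<alpha> (\<lambda>z. \<not> (\<exists>y. z = pair M v y)))"

lemma mem_upd: "mem M z (upd \<alpha> v x) \<longleftrightarrow> z = pair M v x \<or> mem M z \<alpha> \<and> \<not> (\<exists>y. z = pair M v y)"
proof -
  have "dfn1 (\<lambda>z. \<not> (\<exists>y. z = pair M v y))" by (intro dfn_rules)
  then show ?thesis by (simp add: upd_def mem_sep)
qed

lemma mem_pair_upd [simp]: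
  "mem M (pair M u y) (upd \<alpha> v x) \<longleftrightarrow> (if u = v then y = x else mem M (pair M u y) \<alpha>)"
  by (auto simp: mem_upd)

lemma is_fun_upd [simp]: "is_fun M \<alpha> \<Longrightarrow> is_fun M (upd \<alpha> v x)"
  by (auto simp: is_fun_def mem_upd)

definition rst :: "'a \<Rightarrow> 'a \<Rightarrow> 'a" where
  "rst \<alpha> \<phi> = sep \<alpha> (\<lambda>z. \<exists>v x. z = pair M v x \<and> free_in M v \<phi>)"

lemma mem_rst: "mem M z (rst \<alpha> \<phi>) \<longleftrightarrow> mem M z \<alpha> \<and> (\<exists>v x. z = pair M v x \<and> free_in M v \<phi>)"
  unfolding rst_def by (rule mem_sep) (intro dfn_rules)

text \<open>Unlike \<open>is_asg\<close>, this allows values for further variables, so one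
  assignment can serve a formula together with its parts.\<close>

definition covers :: "'a \<Rightarrow> 'a \<Rightarrow> bool" where
  "covers \<alpha> \<phi> \<longleftrightarrow> is_fun M \<alpha> \<and> (\<forall>v. free_in M v \<phi> \<longrightarrow> (\<exists>x. mem M (pair M v x) \<alpha>))"

lemma rst_cong:
  assumes "\<And>v x. free_in M v \<phi> \<Longrightarrow> mem M (pair M v x) \<alpha> \<longleftrightarrow> mem M (pair M v x) \<beta>"
  shows "rst \<alpha> \<phi> = rst \<beta> \<phi>"
  by (rule set_ext) (use assms in \<open>auto simp: mem_rst\<close>)

lemma rst_sub: "(\<And>v. free_in M v \<phi> \<Longrightarrow> free_in M v \<chi>) \<Longrightarrow> rst (rst \<alpha> \<chi>) \<phi> = rst \<alpha> \<phi>"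
  by (rule rst_cong) (auto simp: mem_rst)

lemma is_asg_rst: "covers \<alpha> \<phi> \<Longrightarrow> is_asg M \<phi> (rst \<alpha> \<phi>)"
  unfolding is_asg_def covers_def is_fun_def mem_rst by auto

text \<open>Domain and inclusion in a function leave only one candidate, by extensionality; thus the
  relation \<open>restr\<close> becomes the partial function \<open>rst\<close>.\<close>

lemma restr_iff: "is_fun M \<alpha> \<Longrightarrow> restr M \<alpha> \<phi> \<beta> \<longleftrightarrow> covers \<alpha> \<phi> \<and> \<beta> = rst \<alpha> \<phi>"
proof
  assume "is_fun M \<alpha>" and r: "restr M \<alpha> \<phi> \<beta>"
  then have "covers \<alpha> \<phi>" unfolding restr_def covers_def is_asg_def by blast
  have sub: "mem M z \<beta> \<Longrightarrow> mem M z \<alpha>" for z using r by (simp add: restr_def)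
  have dom: "(\<exists>x. mem M (pair M v x) \<beta>) \<longleftrightarrow> free_in M v \<phi>" for v using r by (simp add: restr_def is_asg_def)
  have prs: "mem M z \<beta> \<Longrightarrow> \<exists>v x. z = pair M v x" for z using r by (simp add: restr_def is_asg_def is_fun_def)
  have "mem M z \<beta> \<longleftrightarrow> mem M z (rst \<alpha> \<phi>)" for z
  proof
    show "mem M z \<beta> \<Longrightarrow> mem M z (rst \<alpha> \<phi>)" using sub dom prs[of z] by (auto simp: mem_rst)
    assume "mem M z (rst \<alpha> \<phi>)"
    then obtain v x where z: "mem M z \<alpha>" "z = pair M v x" "free_in M v \<phi>" by (auto simp: mem_rst)
    then obtain y where y: "mem M (pair M v y) \<beta>" using dom by blast
    then have "x = y" using sub[OF y] z \<open>is_fun M \<alpha>\<close> unfolding is_fun_def by blast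
    then show "mem M z \<beta>" using y z by simp
  qed
  then show "covers \<alpha> \<phi> \<and> \<beta> = rst \<alpha> \<phi>" using \<open>covers \<alpha> \<phi>\<close> set_ext by blast
next
  assume "covers \<alpha> \<phi> \<and> \<beta> = rst \<alpha> \<phi>"
  then show "restr M \<alpha> \<phi> \<beta>" using is_asg_rst by (auto simp: restr_def mem_rst)
qed

lemma rst_sent: "is_sent M \<phi> \<Longrightarrow> rst \<alpha> \<phi> = \<zero>"
  by (rule set_ext) (simp add: mem_rst is_sent_def)

lemma covers_fun: "covers \<alpha> \<phi> \<Longrightarrow> is_fun M \<alpha>"
  by (simp add: covers_def)

lemma is_fun_rst: "is_fun M \<alpha> \<Longrightarrow> is_fun M (rst \<alpha> \<phi>)"
  by (auto simp: is_fun_def mem_rst)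

lemma covers_rst: "covers \<alpha> \<chi> \<Longrightarrow> (\<And>v. free_in M v \<phi> \<Longrightarrow> free_in M v \<chi>) \<Longrightarrow> covers (rst \<alpha> \<chi>) \<phi>"
  unfolding covers_def by (auto simp: mem_rst is_fun_rst)

lemma covers_cOr: "covers \<alpha> (cOr M \<phi> \<psi>) \<longleftrightarrow> covers \<alpha> \<phi> \<and> covers \<alpha> \<psi>"
  and covers_cNeg: "covers \<alpha> (cNeg M \<phi>) \<longleftrightarrow> covers \<alpha> \<phi>"
  by (auto simp: covers_def)

end

locale sat_class = pa M for M :: "'a arith" +
  fixes T :: "('a \<times> 'a) set"
  assumes CS: "CS_minus M T"
begin

text \<open>\<open>T\<close> accepts only assignments with exactly the free variables as domain.
  Trimming at the last moment turns the compositional clauses into the plain Tarski clauses for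
  covering assignments.\<close>

definition Sat :: "'a \<Rightarrow> 'a \<Rightarrow> bool" where
  "Sat \<phi> \<alpha> \<longleftrightarrow> (\<phi>, rst \<alpha> \<phi>) \<in> T"

lemma Sat_cong:
  assumes "\<And>v x. free_in M v \<phi> \<Longrightarrow> mem M (pair M v x) \<alpha> \<longleftrightarrow> mem M (pair M v x) \<beta>"
  shows "Sat \<phi> \<alpha> \<longleftrightarrow> Sat \<phi> \<beta>"
  unfolding Sat_def using rst_cong[OF assms] by simp

lemma Sat_sent: "is_sent M \<phi> \<Longrightarrow> Sat \<phi> \<alpha> \<longleftrightarrow> holds M T \<phi>"
  by (simp add: Sat_def holds_def rst_sent)

lemma Sat_cEq:
  assumes "is_term M s" "is_term M t" "covers \<alpha> (cEq M s t)"
  shows "Sat (cEq M s t) \<alpha> \<longleftrightarrow>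
    (\<exists>x. term_val M (rst \<alpha> (cEq M s t)) s x \<and> term_val M (rst \<alpha> (cEq M s t)) t x)"
  using CS assms is_asg_rst[OF assms(3)] unfolding CS_minus_def Sat_def by simp

lemma Sat_cOr:
  assumes "is_form M \<phi>" "is_form M \<psi>" "covers \<alpha> (cOr M \<phi> \<psi>)"
  shows "Sat (cOr M \<phi> \<psi>) \<alpha> \<longleftrightarrow> Sat \<phi> \<alpha> \<or> Sat \<psi> \<alpha>"
proof -
  let ?\<beta> = "rst \<alpha> (cOr M \<phi> \<psi>)"
  have "Sat (cOr M \<phi> \<psi>) \<alpha> \<longleftrightarrow>
    (\<exists>\<beta>. restr M ?\<beta> \<phi> \<beta> \<and> (\<phi>, \<beta>) \<in> T) \<or> (\<exists>\<beta>. restr M ?\<beta> \<psi> \<beta> \<and> (\<psi>, \<beta>) \<in> T)"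
    using CS assms is_asg_rst[OF assms(3)] unfolding CS_minus_def Sat_def by simp
  moreover have "restr M ?\<beta> \<phi> \<beta> \<longleftrightarrow> \<beta> = rst \<alpha> \<phi>" "restr M ?\<beta> \<psi> \<beta> \<longleftrightarrow> \<beta> = rst \<alpha> \<psi>" for \<beta>
    using assms(3) by (simp_all add: restr_iff is_fun_rst covers_fun covers_rst rst_sub)
  ultimately show ?thesis by (simp add: Sat_def)
qed

lemma Sat_cNeg:
  assumes "is_form M \<phi>" "covers \<alpha> \<phi>"
  shows "Sat (cNeg M \<phi>) \<alpha> \<longleftrightarrow> \<not> Sat \<phi> \<alpha>"
proof -
  have "rst \<alpha> (cNeg M \<phi>) = rst \<alpha> \<phi>" by (rule set_ext) (simp add: mem_rst)
  moreover have "is_asg M (cNeg M \<phi>) (rst \<alpha> \<phi>)" using is_asg_rst[OF assms(2)] by (simp add: is_asg_def)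
  ultimately show ?thesis using CS assms unfolding CS_minus_def Sat_def by simp
qed

lemma Sat_cEx:
  assumes "is_form M \<phi>" "covers \<alpha> (cEx M v \<phi>)"
  shows "Sat (cEx M v \<phi>) \<alpha> \<longleftrightarrow> (\<exists>x. Sat \<phi> (upd \<alpha> v x))"
proof -
  let ?\<beta> = "rst \<alpha> (cEx M v \<phi>)"
  have cov: "covers ?\<beta> (cEx M v \<phi>)" using assms(2) by (rule covers_rst)
  have *: "Sat (cEx M v \<phi>) \<alpha> \<longleftrightarrow>
    (\<exists>\<beta> \<gamma>. differ_at_most M v ?\<beta> \<beta> \<and> restr M \<beta> \<phi> \<gamma> \<and> (\<phi>, \<gamma>) \<in> T)"
    using CS assms is_asg_rst[OF assms(2)] unfolding CS_minus_def Sat_def by simp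
  show ?thesis
  proof
    assume "Sat (cEx M v \<phi>) \<alpha>"
    then obtain \<beta> \<gamma> where d: "differ_at_most M v ?\<beta> \<beta>" and r: "restr M \<beta> \<phi> \<gamma>" and T: "(\<phi>, \<gamma>) \<in> T"
      using * by blast
    have "is_fun M \<beta>" using d by (simp add: differ_at_most_def)
    then have \<beta>: "covers \<beta> \<phi>" "Sat \<phi> \<beta>" using r T restr_iff by (auto simp: Sat_def)
    \<comment> \<open>If \<open>v\<close> is free in \<open>\<phi>\<close>, the witness is its value
      under \<open>\<beta>\<close>; otherwise any element serves, as \<open>Sat\<close> ignores
      \<open>v\<close>.\<close>
    obtain x where x: "free_in M v \<phi> \<longrightarrow> mem M (pair M v x) \<beta>" using \<beta>(1) by (auto simp: covers_def)
    have "Sat \<phi> (upd \<alpha> v x) \<longleftrightarrow> Sat \<phi> \<beta>"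
    proof (rule Sat_cong)
      fix u y assume u: "free_in M u \<phi>"
      show "mem M (pair M u y) (upd \<alpha> v x) \<longleftrightarrow> mem M (pair M u y) \<beta>"
      proof (cases "u = v")
        case True
        then show ?thesis using x u \<open>is_fun M \<beta>\<close> unfolding is_fun_def by auto
      next
        case False
        then have "mem M (pair M u y) \<beta> \<longleftrightarrow> mem M (pair M u y) ?\<beta>" using d by (simp add: differ_at_most_def)
        then show ?thesis using False u by (simp add: mem_rst)
      qed
    qed
    then show "\<exists>x. Sat \<phi> (upd \<alpha> v x)" using \<beta>(2) by blast
  next
    assume "\<exists>x. Sat \<phi> (upd \<alpha> v x)"
    then obtain x where x: "Sat \<phi> (upd \<alpha> v x)" ..
    let ?\<gamma> = "upd ?\<beta> v x"
    have f: "is_fun M ?\<beta>" using assms(2) by (simp add: is_fun_rst covers_fun)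
    have "Sat \<phi> ?\<gamma> \<longleftrightarrow> Sat \<phi> (upd \<alpha> v x)" by (rule Sat_cong) (auto simp: mem_rst)
    then have "(\<phi>, rst ?\<gamma> \<phi>) \<in> T" using x by (simp add: Sat_def)
    moreover have "covers ?\<gamma> \<phi>" unfolding covers_def using f cov by (auto simp: covers_def) metis
    then have "restr M ?\<gamma> \<phi> (rst ?\<gamma> \<phi>)" using restr_iff f by simp
    moreover have "differ_at_most M v ?\<beta> ?\<gamma>" using f by (simp add: differ_at_most_def)
    ultimately show "Sat (cEx M v \<phi>) \<alpha>" using * by blast
  qed
qed

lemma Sat_double:
  assumes "is_fun M \<alpha>" "mem M (pair M n x) \<alpha>" "mem M (pair M w y) \<alpha>"
  shows "Sat (cEq M (cVar M n) (cPlus M (cVar M w) (cVar M w))) \<alpha> \<longleftrightarrow> x = y \<oplus> y"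
    and "Sat (cEq M (cVar M n) (cSucc M (cPlus M (cVar M w) (cVar M w)))) \<alpha> \<longleftrightarrow> x = S (y \<oplus> y)"
proof -
  have uniq: "mem M (pair M v z) \<alpha> \<Longrightarrow> mem M (pair M v z') \<alpha> \<Longrightarrow> z = z'" for v z z'
    using assms(1) unfolding is_fun_def by blast
  have n: "mem M (pair M n z) \<alpha> \<longleftrightarrow> z = x" for z using uniq assms(2) by blast
  have w: "mem M (pair M w z) \<alpha> \<longleftrightarrow> z = y" for z using uniq assms(3) by blast
  have cov: "covers \<alpha> (cEq M (cVar M n) (cPlus M (cVar M w) (cVar M w)))"
    "covers \<alpha> (cEq M (cVar M n) (cSucc M (cPlus M (cVar M w) (cVar M w))))"
    unfolding covers_def using assms by auto
  show "Sat (cEq M (cVar M n) (cPlus M (cVar M w) (cVar M w))) \<alpha> \<longleftrightarrow> x = y \<oplus> y"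
    by (subst Sat_cEq) (auto simp: cov term_val_cVar term_val_double mem_rst n w)
  show "Sat (cEq M (cVar M n) (cSucc M (cPlus M (cVar M w) (cVar M w)))) \<alpha> \<longleftrightarrow> x = S (y \<oplus> y)"
    by (subst Sat_cEq) (auto simp: cov term_val_cVar term_val_S_double mem_rst n w)
qed

end

section \<open>The Yablo sentences\<close>

context pa begin

definition cAnd :: "'a \<Rightarrow> 'a \<Rightarrow> 'a" where
  "cAnd \<phi> \<psi> = cNeg M (cOr M (cNeg M \<phi>) (cNeg M \<psi>))"

definition cIf :: "'a \<Rightarrow> 'a \<Rightarrow> 'a \<Rightarrow> 'a" where
  "cIf \<sigma> \<phi> \<psi> = cOr M (cAnd \<sigma> \<phi>) (cAnd (cNeg M \<sigma>) \<psi>)"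

text \<open>Here \<open>y\<close> is the sentence to stop with and \<open>\<kappa>\<close> the
  continuation. The half of v_n is passed on by binding v_(n+1), which is the free variable of
  \<open>\<kappa>\<close>; this avoids substitution into coded formulas.\<close>

definition step_fm :: "'a \<Rightarrow> 'a \<Rightarrow> 'a \<Rightarrow> 'a \<Rightarrow> 'a" where
  "step_fm n \<sigma> y \<kappa> = (let d = cPlus M (cVar M (S n)) (cVar M (S n)) in
     cEx M (S n) (cOr M
       (cAnd (cEq M (cVar M n) d) (cIf \<sigma> y \<kappa>))
       (cAnd (cEq M (cVar M n) (cSucc M d)) (cIf \<sigma> \<kappa> y))))"

definition nonex :: "'a \<Rightarrow> 'a" where
  "nonex \<phi> = cNeg M (cEx M \<zero> \<phi>)"

text \<open>A placeholder that starts the recursion. Evaluation begins at a nonstandard stage and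
  descends standardly many steps, so it never arrives at stage zero.\<close>

definition trivial_fm :: "'a \<Rightarrow> 'a" where
  "trivial_fm n = cEq M (cVar M n) (cVar M n)"

lemma S_neq_self [simp]: "S n \<noteq> n" "n \<noteq> S n"
  using lt_S_self[of n] by (metis O.less_irrefl)+

lemma is_form_step_fm: "is_form M (step_fm n \<sigma> y \<kappa>) \<longleftrightarrow> is_form M \<sigma> \<and> is_form M y \<and> is_form M \<kappa>"
  by (auto simp: step_fm_def cIf_def cAnd_def Let_def)

lemma free_in_step_fm:
  "free_in M v (step_fm n \<sigma> y \<kappa>) \<longleftrightarrow>
    v = n \<or> v \<noteq> S n \<and> (free_in M v \<sigma> \<or> free_in M v y \<or> free_in M v \<kappa>)"
  by (auto simp: step_fm_def cIf_def cAnd_def Let_def)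

text \<open>The internal recursion also visits nonstandard positions, where the entry of
  \<open>a\<close> may be missing or fail to be a sentence; a default sentence makes the function
  total.\<close>

definition nth_sent :: "'a \<Rightarrow> 'a \<Rightarrow> 'a" where
  "nth_sent a n = (if \<exists>x. seq_nth M a n x \<and> is_sent M x then THE x. seq_nth M a n x
     else nonex (trivial_fm \<zero>))"

lemma seq_nth_unique: "seq_nth M a n x \<Longrightarrow> seq_nth M a n y \<Longrightarrow> x = y"
  unfolding seq_nth_def is_seq_def is_fun_def by blast

lemma nth_sent_eq: "seq_nth M a n x \<Longrightarrow> is_sent M x \<Longrightarrow> nth_sent a n = x"
  unfolding nth_sent_def using seq_nth_unique by (auto intro!: the_equality)

lemma nth_sent_iff: "nth_sent a n = x \<longleftrightarrow> seq_nth M a n x \<and> is_sent M x \<or>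
    \<not> (\<exists>y. seq_nth M a n y \<and> is_sent M y) \<and> x = nonex (trivial_fm \<zero>)"
proof (cases "\<exists>y. seq_nth M a n y \<and> is_sent M y")
  case True
  then show ?thesis using nth_sent_eq by metis
next
  case False
  then show ?thesis by (auto simp: nth_sent_def)
qed

lemma is_sent_nth_sent: "is_sent M (nth_sent a n)"
proof -
  have "is_sent M (nonex (trivial_fm \<zero>))" by (simp add: is_sent_def nonex_def trivial_fm_def)
  then show ?thesis using nth_sent_iff[of a n "nth_sent a n"] by auto
qed

lemma dfn_nth_sent: "dterm M UNIV f \<Longrightarrow> dterm M UNIV g \<Longrightarrow> dfn M UNIV (\<lambda>e. nth_sent a (f e) = g e)"
  by (rule dfn_subst2) (unfold nth_sent_iff nonex_def trivial_fm_def code_defs, intro dfn_rules)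

text \<open>A stage is defined through a coded derivation of the single triple (m, n, \<phi>). A
  table of stage m for all n would be unbounded, but one derivation visits only a set that is finite
  in the sense of \<open>M\<close>, even for nonstandard m.\<close>

definition stage_rule :: "'a \<Rightarrow> ('a \<Rightarrow> bool) \<Rightarrow> 'a \<Rightarrow> bool" where
  "stage_rule a P z \<longleftrightarrow>
     (\<exists>n. z = pair M \<zero> (pair M n (trivial_fm n))) \<or>
     (\<exists>m n \<sigma> \<phi> \<kappa>. z = pair M (S m) (pair M n (step_fm n \<sigma> (nonex \<phi>) \<kappa>)) \<and> nth_sent a n = \<sigma> \<and>
        P (pair M m (pair M \<zero> \<phi>)) \<and> P (pair M m (pair M (S n) \<kappa>)))"

definition stage_rel :: "'a \<Rightarrow> 'a \<Rightarrow> 'a \<Rightarrow> 'a \<Rightarrow> bool" where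
  "stage_rel a m n \<phi> \<longleftrightarrow> formed (stage_rule a) (pair M m (pair M n \<phi>))"

lemma formed_stage_rule: "formed (stage_rule a) z \<longleftrightarrow> stage_rule a (formed (stage_rule a)) z"
proof (rule formed_iff)
  show "stage_rule a P x \<Longrightarrow> (\<And>s. P s \<Longrightarrow> Q s) \<Longrightarrow> stage_rule a Q x" for P Q x
    unfolding stage_rule_def by blast
  show "stage_rule a P x \<Longrightarrow>
    stage_rule a (\<lambda>_. False) x \<or> (\<exists>b c. P b \<and> P c \<and> stage_rule a (\<lambda>s. s = b \<or> s = c) x)" for P x
    unfolding stage_rule_def by blast
qed

lemma stage_rel_zero: "stage_rel a \<zero> n \<phi> \<longleftrightarrow> \<phi> = trivial_fm n"
  unfolding stage_rel_def by (subst formed_stage_rule) (auto simp: stage_rule_def)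

lemma stage_rel_S: "stage_rel a (S m) n \<chi> \<longleftrightarrow>
    (\<exists>\<phi> \<kappa>. \<chi> = step_fm n (nth_sent a n) (nonex \<phi>) \<kappa> \<and> stage_rel a m \<zero> \<phi> \<and> stage_rel a m (S n) \<kappa>)"
  unfolding stage_rel_def by (subst formed_stage_rule) (auto simp: stage_rule_def)

lemma dfn_stage_rel:
  assumes "dterm M UNIV f" "dterm M UNIV g" "dterm M UNIV h"
  shows "dfn M UNIV (\<lambda>e. stage_rel a (f e) (g e) (h e))"
proof -
  have "dfn1 (formed (stage_rule a))"
    unfolding formed_def stage_rule_def step_fm_def cIf_def cAnd_def Let_def nonex_def trivial_fm_def code_defs
    by (intro dfn_nth_sent dfn_rules)
  then show ?thesis unfolding stage_rel_def by (rule dfn_subst1) (intro assms dfn_rules)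
qed

text \<open>The induction takes place inside \<open>M\<close> and so reaches nonstandard stages. It
  must carry all \<open>n\<close> at once, since position \<open>n\<close> of one stage calls
  positions \<zero> and \<open>S n\<close> of the stage below.\<close>

lemma stage_rel_ex1: "\<exists>!\<phi>. stage_rel a m n \<phi>"
proof -
  have "\<forall>n. \<exists>!\<phi>. stage_rel a m n \<phi>"
  proof (rule ind[where P = "\<lambda>m. \<forall>n. \<exists>!\<phi>. stage_rel a m n \<phi>"])
    show "dfn1 (\<lambda>m. \<forall>n. \<exists>!\<phi>. stage_rel a m n \<phi>)" unfolding Ex1_def by (intro dfn_stage_rel dfn_rules)
    show "\<forall>n. \<exists>!\<phi>. stage_rel a \<zero> n \<phi>" by (simp add: stage_rel_zero)
    fix m assume "\<forall>n. \<exists>!\<phi>. stage_rel a m n \<phi>"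
    then show "\<forall>n. \<exists>!\<phi>. stage_rel a (S m) n \<phi>" unfolding stage_rel_S by metis
  qed
  then show ?thesis by blast
qed

definition stage :: "'a \<Rightarrow> 'a \<Rightarrow> 'a \<Rightarrow> 'a" where
  "stage a m n = (THE \<phi>. stage_rel a m n \<phi>)"

lemma stage_rel_iff: "stage_rel a m n \<phi> \<longleftrightarrow> \<phi> = stage a m n"
  unfolding stage_def by (auto intro: theI'[OF stage_rel_ex1] the1_equality[OF stage_rel_ex1, symmetric])

lemma stage_S: "stage a (S m) n = step_fm n (nth_sent a n) (nonex (stage a m \<zero>)) (stage a m (S n))"
  using stage_rel_S[of a m n "stage a (S m) n"] by (simp add: stage_rel_iff)

lemma stage_form: "is_form M (stage a m n)"
  and stage_free: "free_in M v (stage a m n) \<Longrightarrow> v = n"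
proof -
  \<comment> \<open>Phrased with the definable relation in place of the function
    \<open>stage\<close>, so that induction in \<open>M\<close> applies.\<close>
  have "\<forall>n \<phi>. stage_rel a m n \<phi> \<longrightarrow> is_form M \<phi> \<and> (\<forall>v. free_in M v \<phi> \<longrightarrow> v = n)"
  proof (rule ind[where P = "\<lambda>m. \<forall>n \<phi>. stage_rel a m n \<phi> \<longrightarrow> is_form M \<phi> \<and> (\<forall>v. free_in M v \<phi> \<longrightarrow> v = n)"])
    show "dfn1 (\<lambda>m. \<forall>n \<phi>. stage_rel a m n \<phi> \<longrightarrow> is_form M \<phi> \<and> (\<forall>v. free_in M v \<phi> \<longrightarrow> v = n))"
      by (intro dfn_stage_rel dfn_rules)
    show "\<forall>n \<phi>. stage_rel a \<zero> n \<phi> \<longrightarrow> is_form M \<phi> \<and> (\<forall>v. free_in M v \<phi> \<longrightarrow> v = n)"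
      by (auto simp: stage_rel_zero trivial_fm_def)
    fix m assume IH: "\<forall>n \<phi>. stage_rel a m n \<phi> \<longrightarrow> is_form M \<phi> \<and> (\<forall>v. free_in M v \<phi> \<longrightarrow> v = n)"
    show "\<forall>n \<phi>. stage_rel a (S m) n \<phi> \<longrightarrow> is_form M \<phi> \<and> (\<forall>v. free_in M v \<phi> \<longrightarrow> v = n)"
    proof (intro allI impI)
      fix n \<chi> assume "stage_rel a (S m) n \<chi>"
      then obtain \<phi> \<kappa> where \<chi>: "\<chi> = step_fm n (nth_sent a n) (nonex \<phi>) \<kappa>" "stage_rel a m \<zero> \<phi>" "stage_rel a m (S n) \<kappa>"
        by (auto simp: stage_rel_S)
      have "is_form M \<phi>" "\<And>v. free_in M v \<phi> \<Longrightarrow> v = \<zero>" using IH \<chi>(2) by blast+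
      moreover have "is_form M \<kappa>" "\<And>v. free_in M v \<kappa> \<Longrightarrow> v = S n" using IH \<chi>(3) by blast+
      ultimately show "is_form M \<chi> \<and> (\<forall>v. free_in M v \<chi> \<longrightarrow> v = n)"
        using is_sent_nth_sent[of a n] unfolding \<chi>(1)
        by (auto simp: is_form_step_fm free_in_step_fm nonex_def is_sent_def)
    qed
  qed
  then show "is_form M (stage a m n)" "free_in M v (stage a m n) \<Longrightarrow> v = n" using stage_rel_iff by blast+
qed

lemma is_sent_nonex_stage: "is_sent M (nonex (stage a m \<zero>))"
  using stage_form by (auto simp: is_sent_def nonex_def dest: stage_free)

end

context sat_class begin

section \<open>Truth of the stages\<close>

lemma Sat_cAnd:
  assumes "is_form M \<phi>" "is_form M \<psi>" "covers \<alpha> \<phi>" "covers \<alpha> \<psi>"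
  shows "Sat (cAnd \<phi> \<psi>) \<alpha> \<longleftrightarrow> Sat \<phi> \<alpha> \<and> Sat \<psi> \<alpha>"
  using assms by (simp add: cAnd_def Sat_cNeg Sat_cOr covers_cOr covers_cNeg)

lemma covers_cAnd: "covers \<alpha> (cAnd \<phi> \<psi>) \<longleftrightarrow> covers \<alpha> \<phi> \<and> covers \<alpha> \<psi>"
  by (simp add: cAnd_def covers_cOr covers_cNeg)

lemma is_form_cAnd: "is_form M (cAnd \<phi> \<psi>) \<longleftrightarrow> is_form M \<phi> \<and> is_form M \<psi>"
  by (simp add: cAnd_def)

lemma Sat_cIf:
  assumes "is_form M \<sigma>" "is_form M \<phi>" "is_form M \<psi>" "covers \<alpha> \<sigma>" "covers \<alpha> \<phi>" "covers \<alpha> \<psi>"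
  shows "Sat (cIf \<sigma> \<phi> \<psi>) \<alpha> \<longleftrightarrow> (if Sat \<sigma> \<alpha> then Sat \<phi> \<alpha> else Sat \<psi> \<alpha>)"
  using assms by (simp add: cIf_def Sat_cAnd Sat_cOr Sat_cNeg covers_cOr covers_cNeg covers_cAnd is_form_cAnd)

lemma Sat_step_fm:
  assumes \<sigma>: "is_sent M \<sigma>" and y: "is_sent M y" and \<kappa>: "is_form M \<kappa>" "\<And>v. free_in M v \<kappa> \<Longrightarrow> v = S n"
    and \<alpha>: "is_fun M \<alpha>" "mem M (pair M n x) \<alpha>"
  shows "Sat (step_fm n \<sigma> y \<kappa>) \<alpha> \<longleftrightarrow>
    (\<exists>z. x = z \<oplus> z \<and> (if holds M T \<sigma> then holds M T y else Sat \<kappa> (upd \<alpha> (S n) z)) \<or>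
         x = S (z \<oplus> z) \<and> (if holds M T \<sigma> then Sat \<kappa> (upd \<alpha> (S n) z) else holds M T y))"
proof -
  let ?d = "cPlus M (cVar M (S n)) (cVar M (S n))"
  let ?A = "cEq M (cVar M n) ?d" and ?B = "cEq M (cVar M n) (cSucc M ?d)"
  let ?\<chi> = "cOr M (cAnd ?A (cIf \<sigma> y \<kappa>)) (cAnd ?B (cIf \<sigma> \<kappa> y))"
  have forms: "is_form M \<sigma>" "is_form M y" "is_form M ?A" "is_form M ?B" "is_form M (cIf \<sigma> y \<kappa>)"
    "is_form M (cIf \<sigma> \<kappa> y)"
    using \<sigma> y \<kappa>(1) by (auto simp: is_sent_def cIf_def is_form_cAnd)
  have val: "Sat ?\<chi> (upd \<alpha> (S n) z) \<longleftrightarrow>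
    x = z \<oplus> z \<and> (if holds M T \<sigma> then holds M T y else Sat \<kappa> (upd \<alpha> (S n) z)) \<or>
    x = S (z \<oplus> z) \<and> (if holds M T \<sigma> then Sat \<kappa> (upd \<alpha> (S n) z) else holds M T y)" for z
  proof -
    let ?\<beta> = "upd \<alpha> (S n) z"
    have f: "is_fun M ?\<beta>" and m: "mem M (pair M n x) ?\<beta>" "mem M (pair M (S n) z) ?\<beta>"
      using \<alpha> by simp_all
    have cov: "covers ?\<beta> \<sigma>" "covers ?\<beta> y" "covers ?\<beta> \<kappa>" "covers ?\<beta> ?A" "covers ?\<beta> ?B"
      using f \<sigma> y \<kappa>(2) m by (auto simp: covers_def is_sent_def)
    then have "covers ?\<beta> (cIf \<sigma> y \<kappa>)" "covers ?\<beta> (cIf \<sigma> \<kappa> y)"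
      by (simp_all add: cIf_def covers_cOr covers_cNeg covers_cAnd)
    then show ?thesis using cov forms \<kappa>(1)
      by (simp add: Sat_cOr Sat_cAnd Sat_cIf covers_cOr covers_cAnd is_form_cAnd Sat_double[OF f m]
        Sat_sent[OF \<sigma>] Sat_sent[OF y])
  qed
  have "free_in M v (cEx M (S n) ?\<chi>) \<Longrightarrow> v = n" for v
    using \<sigma> y \<kappa>(2) unfolding cIf_def cAnd_def is_sent_def by auto
  then have "covers \<alpha> (cEx M (S n) ?\<chi>)" unfolding covers_def using \<alpha> by blast
  moreover have "is_form M ?\<chi>" using forms by (simp add: is_form_cAnd)
  ultimately show ?thesis unfolding step_fm_def Let_def using val by (simp add: Sat_cEx)
qed

lemma Sat_stage_S:
  assumes "is_fun M \<alpha>" "mem M (pair M n x) \<alpha>" "x = z \<oplus> z \<or> x = S (z \<oplus> z)"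
  shows "Sat (stage a (S m) n) \<alpha> \<longleftrightarrow>
    (if mem M \<zero> x \<longleftrightarrow> holds M T (nth_sent a n) then Sat (stage a m (S n)) (upd \<alpha> (S n) z)
     else holds M T (nonex (stage a m \<zero>)))"
proof -
  have "mem M \<zero> x \<longleftrightarrow> x = S (z \<oplus> z)" using assms(3) by (auto simp: mem_zero_iff)
  then show ?thesis unfolding stage_S
    using Sat_step_fm[OF is_sent_nth_sent is_sent_nonex_stage stage_form stage_free assms(1,2)] assms(3) by auto
qed

text \<open>\<open>i\<close> is the distance from position \<open>k\<close> to the first mismatch.
  Each agreement costs one stage and one halving, and the mismatch itself one more stage, hence
  \<open>Suc i\<close>. The induction is over \<open>nat\<close> because it speaks about
  truth.\<close>

lemma Sat_stage:
  assumes "\<And>j. j < i \<Longrightarrow> mem M (num M j) x \<longleftrightarrow> holds M T (nth_sent a (num M (k + j)))"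
    and "mem M (num M i) x \<longleftrightarrow> \<not> holds M T (nth_sent a (num M (k + i)))"
    and "is_fun M \<alpha>" "mem M (pair M (num M k) x) \<alpha>"
  shows "Sat (stage a ((S ^^ Suc i) m) (num M k)) \<alpha> \<longleftrightarrow> holds M T (nonex (stage a m \<zero>))"
  using assms
proof (induction i arbitrary: k x \<alpha>)
  case 0
  obtain z where z: "x = z \<oplus> z \<or> x = S (z \<oplus> z)" using parity by blast
  show ?case using Sat_stage_S[OF 0(3,4) z, of a m] 0(2) by (simp add: num_simps)
next
  case (Suc i)
  obtain z where z: "x = z \<oplus> z \<or> x = S (z \<oplus> z)" using parity by blast
  let ?\<beta> = "upd \<alpha> (S (num M k)) z"
  have shift: "mem M (num M (Suc j)) x \<longleftrightarrow> mem M (num M j) z" for j using z by (auto simp: num_simps)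
  have "mem M \<zero> x \<longleftrightarrow> holds M T (nth_sent a (num M k))" using Suc.prems(1)[of 0] by (simp add: num_simps)
  then have "Sat (stage a ((S ^^ Suc (Suc i)) m) (num M k)) \<alpha> \<longleftrightarrow>
      Sat (stage a ((S ^^ Suc i) m) (num M (Suc k))) ?\<beta>"
    using Sat_stage_S[OF Suc.prems(3,4) z, of a "(S ^^ Suc i) m"] by (simp add: num_simps)
  also have "\<dots> \<longleftrightarrow> holds M T (nonex (stage a m \<zero>))"
  proof (rule Suc.IH)
    show "mem M (num M j) z \<longleftrightarrow> holds M T (nth_sent a (num M (Suc k + j)))" if "j < i" for j
      using Suc.prems(1)[of "Suc j"] that shift[of j] by simp
    show "mem M (num M i) z \<longleftrightarrow> \<not> holds M T (nth_sent a (num M (Suc k + i)))"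
      using Suc.prems(2) shift[of i] by simp
    show "is_fun M ?\<beta>" using Suc.prems(3) by simp
    show "mem M (pair M (num M (Suc k)) z) ?\<beta>" by (simp add: num_simps)
  qed
  finally show ?case .
qed

text \<open>The pattern \<open>b\<close> need not be definable, but only standardly many digits are
  prescribed, so external induction suffices.\<close>

lemma digits_ex: "\<exists>x. \<forall>j<n. mem M (num M j) x \<longleftrightarrow> b j"
proof (induction n)
  case (Suc n)
  then obtain x where x: "\<forall>j<n. mem M (num M j) x \<longleftrightarrow> b j" by blast
  show ?case
  proof (cases "b n")
    case True
    then show ?thesis using x by (intro exI[of _ "ins (num M n) x"]) (auto simp: less_Suc_eq)
  next
    case False
    let ?x = "sep x (\<lambda>z. z \<noteq> num M n)"
    have "mem M z ?x \<longleftrightarrow> mem M z x \<and> z \<noteq> num M n" for z by (rule mem_sep) (intro dfn_rules)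
    then show ?thesis using x False by (intro exI[of _ ?x]) (auto simp: less_Suc_eq)
  qed
qed simp

lemma truth_coded:
  assumes d: "\<And>n. d \<noteq> num M n"
  shows "\<exists>c. \<forall>n. mem M (num M n) c \<longleftrightarrow> holds M T (nth_sent a (num M n))"
proof (rule ccontr)
  define t where "t n = holds M T (nth_sent a (num M n))" for n
  assume "\<not> ?thesis"
  then have diff: "\<exists>n. mem M (num M n) x \<noteq> t n" for x by (auto simp: t_def)
  \<comment> \<open>Existence of d - i: the descent cannot hit \<zero>, or \<open>d\<close> would be
    the numeral of \<open>i\<close>.\<close>
  have "\<exists>m. (S ^^ i) m = d" for i
  proof (induction i)
    case (Suc i)
    then obtain m where m: "(S ^^ i) m = d" by blast
    have "m \<noteq> \<zero>" using d[of i] m by (auto simp: num_def)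
    then obtain m' where "m = S m'" using zero_or_S by blast
    then show ?case using m by (auto simp: funpow_swap1 intro!: exI[of _ m'])
  qed simp
  then obtain p where p: "\<And>i. (S ^^ i) (p i) = d" by metis
  have S_pow_inj: "(S ^^ i) x = (S ^^ i) y \<Longrightarrow> x = y" for i x y by (induction i) simp_all
  have p_add: "p k = (S ^^ i) (p (k + i))" for k i
    using p[of k] p[of "k + i"] S_pow_inj[of k] by (simp add: funpow_add)
  \<comment> \<open>The order is reversed: \<open>p k\<close> is d - k, so a larger \<open>k\<close>
    means a lower stage.\<close>
  define Y where "Y k = holds M T (nonex (stage a (p k) \<zero>))" for k
  have Y: "Y k \<longleftrightarrow> (\<forall>i. \<not> Y (k + Suc i))" for k
  proof -
    have ev: "Sat (stage a (p k) \<zero>) (upd \<zero> \<zero> x) \<longleftrightarrow> Y (k + Suc i)"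
      if "\<And>j. j < i \<Longrightarrow> mem M (num M j) x \<longleftrightarrow> t j" "mem M (num M i) x \<noteq> t i" for i x
      using Sat_stage[of i x a 0 "upd \<zero> \<zero> x" "p (k + Suc i)"] that p_add[of k "Suc i"]
      by (simp add: t_def Y_def num_simps)
    have cov: "covers \<zero> (cEx M \<zero> (stage a (p k) \<zero>))"
      using stage_free by (auto simp: covers_def)
    have "Y k \<longleftrightarrow> Sat (nonex (stage a (p k) \<zero>)) \<zero>"
      by (simp add: Y_def Sat_sent is_sent_nonex_stage)
    then have "Y k \<longleftrightarrow> \<not> Sat (cEx M \<zero> (stage a (p k) \<zero>)) \<zero>"
      using cov stage_form by (simp add: nonex_def Sat_cNeg)
    then have *: "Y k \<longleftrightarrow> (\<forall>x. \<not> Sat (stage a (p k) \<zero>) (upd \<zero> \<zero> x))"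
      using cov stage_form by (simp add: Sat_cEx)
    show ?thesis unfolding *
    proof (intro iffI allI)
      fix i assume no: "\<forall>x. \<not> Sat (stage a (p k) \<zero>) (upd \<zero> \<zero> x)"
      \<comment> \<open>Digits that agree with the truth values below \<open>i\<close> and disagree
        at \<open>i\<close> force the first mismatch to be \<open>i\<close>.\<close>
      obtain x where "\<forall>j<Suc i. mem M (num M j) x \<longleftrightarrow> (if j = i then \<not> t i else t j)"
        using digits_ex[of "Suc i" "\<lambda>j. if j = i then \<not> t i else t j"] ..
      then show "\<not> Y (k + Suc i)" using ev[of i x] no by simp
    next
      fix x assume no: "\<forall>i. \<not> Y (k + Suc i)"
      \<comment> \<open>The assumption that the true positions are not coded is spent here: every
        \<open>x\<close> has a mismatch at a standard position, and so a least one.\<close>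
      define i where "i = (LEAST n. mem M (num M n) x \<noteq> t n)"
      have "mem M (num M i) x \<noteq> t i" unfolding i_def using diff by (rule LeastI_ex)
      moreover have "mem M (num M j) x \<longleftrightarrow> t j" if "j < i" for j
        using that not_less_Least unfolding i_def by blast
      ultimately show "\<not> Sat (stage a (p k) \<zero>) (upd \<zero> \<zero> x)" using ev[of i x] no by blast
    qed
  qed
  \<comment> \<open>Yablo's argument: \<open>Y k\<close> makes all later ones fail, but
    \<open>Y (k + 1)\<close> can fail only if some still later one holds. So all of them fail, and
    that is just what makes \<open>Y 0\<close> hold.\<close>
  have "\<not> Y k" for k
  proof
    assume "Y k"
    then have no: "\<not> Y (k + Suc i)" for i using Y[of k] by blast
    then obtain i where "Y (k + 1 + Suc i)" using Y[of "k + 1"] no[of 0] by auto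
    then show False using no[of "Suc i"] by simp
  qed
  then show False using Y[of 0] by blast
qed

end

theorem theorem2p9:
  fixes M :: "'a arith" and S :: "('a \<times> 'a) set" and D A :: "'a set"
  assumes "CS_minus M S"
    and "\<forall>\<phi>\<in>D. is_sent M \<phi>"
    and "A = {\<phi> \<in> D. holds M S \<phi>}"
  shows "separable M A D"
proof -
  interpret sat_class M S
    using assms(1) by unfold_locales (auto simp: CS_minus_def)
  have "\<exists>c. \<forall>n. (\<exists>x\<in>A. seq_nth M a (num M n) x) \<longleftrightarrow> mem M (num M n) c"
    if a: "\<forall>n. \<exists>x\<in>D. seq_nth M a (num M n) x" for a
  proof -
    \<comment> \<open>\<open>d\<close> is the length of \<open>a\<close>. As all standard positions
      are occupied it lies above every numeral, which provides the nonstandard element.\<close>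
    obtain d where d: "\<And>i. (\<exists>x. mem M (pair M i x) a) \<longleftrightarrow> lt M i d"
      using a unfolding seq_nth_def is_seq_def by blast
    have "lt M (num M n) d" for n using a d unfolding seq_nth_def by blast
    then have "d \<noteq> num M n" for n using O.less_irrefl by metis
    then obtain c where c: "\<And>n. mem M (num M n) c \<longleftrightarrow> holds M S (nth_sent a (num M n))"
      using truth_coded by blast
    have "(\<exists>x\<in>A. seq_nth M a (num M n) x) \<longleftrightarrow> holds M S (nth_sent a (num M n))" for n
    proof -
      obtain x where x: "x \<in> D" "seq_nth M a (num M n) x" using a by blast
      then have "nth_sent a (num M n) = x" using nth_sent_eq assms(2) by blast
      then show ?thesis using x seq_nth_unique assms(3) by blast
    qed
    then show ?thesis using c by blast
  qed
  then show ?thesis unfolding separable_def using assms(3) by blast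
qed

end
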